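(* Let $(\sigma,\tau)$ be chosen uniformly at random from $S_n\times S_n$. Then the probability that the square-tiled surface $S(\sigma,\tau)$ is single-banded is asymptotically $1$; more precisely, as $n\to\infty$, $$\Pr[S(\sigma,\tau)\text{ is single-banded}] = 1-O\left(\frac1n\right).$$
   Context: $S_n$ is the symmetric group on $\{1,\dots,n\}$. For $\sigma,\tau\in S_n$, $S(\sigma,\tau)$ is the (labelled, not necessarily connected) square-tiled surface built from $n$ axis-parallel unit squares labelled $1,\dots,n$, where the right side of square $j$ is glued by translation to the left side of square $\sigma(j)$ and the top side of square $j$ is glued by translation to the bottom side of square $\tau(j)$. The total angle at each vertex (point of the surface coming from corners of squares) is $2\pi\ell$ for an integer $\ell\ge1$; vertices with $\ell>1$ are called cone points. On a component with no cone points, one vertex is marked and plays the role of a cone point. A saddle connection is a straight segment joining cone points (possibly the same one) with no cone point in its interior. A horizontal cylinder is an isometrically embedded copy of $(\mathbb{R}/c\mathbb{Z})\times(0,h)$ ($c,h>0$), with horizontal core curves; a maximal one has no cone point in its interior and boundary a union of horizontal saddle connections. The surface decomposes into maximal horizontal cylinders. It is called single-banded if every maximal horizontal cylinder is made of a single band of squares, i.e. is isometric to $(\mathbb{R}/k\mathbb{Z})\times(0,1)$ for some $k\in\mathbb{N}$; otherwise it is multi-banded. *)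

theory Defs
  imports "HOL-Analysis.Analysis" "HOL-Probability.Probability"
    "HOL-Combinatorics.Permutations" "HOL-Library.Landau_Symbols"
begin

text \<open>
  A pair \<open>(j, x, y)\<close> is the point with coordinates \<open>(x, y)\<close> of the closed unit square labelled \<open>j\<close>.
  A point of the surface is the set of all such pairs that are identified by the gluing.
\<close>

type_synonym square_point = "nat \<times> real \<times> real"
type_synonym surface_point = "square_point set"

definition unit_square :: "(real \<times> real) set" where
  "unit_square = {0..1} \<times> {0..1}"

definition squares :: "nat \<Rightarrow> square_point set" where
  "squares n = {1..n} \<times> unit_square"

definition gluing :: "nat \<Rightarrow> (nat \<Rightarrow> nat) \<Rightarrow> (nat \<Rightarrow> nat) \<Rightarrow> square_point rel" where
  "gluing n \<sigma> \<tau> =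
     {((j, 1, y), (\<sigma> j, 0, y)) | j y. j \<in> {1..n} \<and> y \<in> {0..1}} \<union>
     {((j, x, 1), (\<tau> j, x, 0)) | j x. j \<in> {1..n} \<and> x \<in> {0..1}}"

definition identified :: "nat \<Rightarrow> (nat \<Rightarrow> nat) \<Rightarrow> (nat \<Rightarrow> nat) \<Rightarrow> square_point rel" where
  "identified n \<sigma> \<tau> = (gluing n \<sigma> \<tau> \<union> (gluing n \<sigma> \<tau>)\<inverse>)\<^sup>*"

definition proj :: "nat \<Rightarrow> (nat \<Rightarrow> nat) \<Rightarrow> (nat \<Rightarrow> nat) \<Rightarrow> square_point \<Rightarrow> surface_point" where
  "proj n \<sigma> \<tau> p = identified n \<sigma> \<tau> `` {p}"

definition surface :: "nat \<Rightarrow> (nat \<Rightarrow> nat) \<Rightarrow> (nat \<Rightarrow> nat) \<Rightarrow> surface_point set" where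
  "surface n \<sigma> \<tau> = squares n // identified n \<sigma> \<tau>"

definition vertices :: "nat \<Rightarrow> (nat \<Rightarrow> nat) \<Rightarrow> (nat \<Rightarrow> nat) \<Rightarrow> surface_point set" where
  "vertices n \<sigma> \<tau> = proj n \<sigma> \<tau> ` ({1..n} \<times> {0, 1} \<times> {0, 1})"

text \<open>
  The elements of a vertex are exactly the corners of squares that are glued together there, and
  each of them contributes a right angle.
\<close>

definition total_angle :: "surface_point \<Rightarrow> real" where
  "total_angle v = real (card v) * (pi / 2)"

definition angular_cone_points ::
    "nat \<Rightarrow> (nat \<Rightarrow> nat) \<Rightarrow> (nat \<Rightarrow> nat) \<Rightarrow> surface_point set" where
  "angular_cone_points n \<sigma> \<tau> = {v \<in> vertices n \<sigma> \<tau>. total_angle v > 2 * pi}"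

text \<open>A connected component is represented by the set of labels of its squares.\<close>

definition adjacent :: "nat \<Rightarrow> (nat \<Rightarrow> nat) \<Rightarrow> (nat \<Rightarrow> nat) \<Rightarrow> nat rel" where
  "adjacent n \<sigma> \<tau> = {(j, \<sigma> j) | j. j \<in> {1..n}} \<union> {(j, \<tau> j) | j. j \<in> {1..n}}"

definition components :: "nat \<Rightarrow> (nat \<Rightarrow> nat) \<Rightarrow> (nat \<Rightarrow> nat) \<Rightarrow> nat set set" where
  "components n \<sigma> \<tau> = {1..n} // (adjacent n \<sigma> \<tau> \<union> (adjacent n \<sigma> \<tau>)\<inverse>)\<^sup>*"

definition lies_on :: "surface_point \<Rightarrow> nat set \<Rightarrow> bool" where
  "lies_on p K \<longleftrightarrow> fst ` p \<subseteq> K"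

text \<open>
  A marking selects exactly one vertex on each component without a vertex of angle greater than
  \<open>2 * pi\<close>, and nothing on the other components.
\<close>

definition marking ::
    "nat \<Rightarrow> (nat \<Rightarrow> nat) \<Rightarrow> (nat \<Rightarrow> nat) \<Rightarrow> surface_point set \<Rightarrow> bool" where
  "marking n \<sigma> \<tau> M \<longleftrightarrow> M \<subseteq> vertices n \<sigma> \<tau> \<and>
     (\<forall>K\<in>components n \<sigma> \<tau>.
        if \<exists>v\<in>angular_cone_points n \<sigma> \<tau>. lies_on v K
        then \<not> (\<exists>v\<in>M. lies_on v K)
        else \<exists>!v. v \<in> M \<and> lies_on v K)"

text \<open>Every surface has a marking, so a choice of markings as in the theorem exists.\<close>

lemma marking_exists:
  "\<exists>M. marking n \<sigma> \<tau> M"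
proof -
  let ?r = "(adjacent n \<sigma> \<tau> \<union> (adjacent n \<sigma> \<tau>)\<inverse>)\<^sup>*"
  let ?g = "gluing n \<sigma> \<tau> \<union> (gluing n \<sigma> \<tau>)\<inverse>"
  have sym: "sym ?r"
    by (rule sym_rtrancl) (auto simp: sym_def)
  have step: "(fst p, fst q) \<in> ?r" if "(p, q) \<in> ?g" for p q
  proof -
    have "(fst p, fst q) \<in> adjacent n \<sigma> \<tau> \<union> (adjacent n \<sigma> \<tau>)\<inverse>"
      using that by (auto simp: gluing_def adjacent_def)
    then show ?thesis by blast
  qed
  have label: "(fst p, fst q) \<in> ?r" if "(p, q) \<in> identified n \<sigma> \<tau>" for p q
    using that unfolding identified_def
    by (induction rule: rtrancl_induct) (auto intro: rtrancl_trans step)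
  have self: "p \<in> proj n \<sigma> \<tau> p" for p
    by (simp add: proj_def identified_def)
  have lies: "lies_on (proj n \<sigma> \<tau> (j, 0, 0)) K"
    if "K \<in> components n \<sigma> \<tau>" "j \<in> K" for K j
  proof -
    from that(1) obtain a where K: "K = ?r `` {a}"
      unfolding components_def by (elim quotientE)
    show ?thesis
      using that(2) unfolding lies_on_def proj_def K
      by (auto dest!: label intro: rtrancl_trans)
  qed
  have disj: "K = L"
    if "K \<in> components n \<sigma> \<tau>" "L \<in> components n \<sigma> \<tau>" "x \<in> K" "x \<in> L" for K L x
  proof -
    from that(1,2) obtain a b where KL: "K = ?r `` {a}" "L = ?r `` {b}"
      unfolding components_def by (metis quotientE)
    then have ax: "(a, x) \<in> ?r" and bx: "(b, x) \<in> ?r" using that by auto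
    then have "(x, a) \<in> ?r" "(x, b) \<in> ?r" using sym by (meson symD)+
    then have "(a, b) \<in> ?r" "(b, a) \<in> ?r" using ax bx by (meson rtrancl_trans)+
    then show ?thesis unfolding KL
      by (meson Image_singleton_iff rtrancl_trans set_eqI)
  qed
  have ne: "\<exists>j. j \<in> K \<and> j \<in> {1..n}" if "K \<in> components n \<sigma> \<tau>" for K
    using that unfolding components_def quotient_def by blast
  define j where "j K = (SOME j. j \<in> K \<and> j \<in> {1..n})" for K
  have j: "j K \<in> K" "j K \<in> {1..n}" if "K \<in> components n \<sigma> \<tau>" for K
    using someI_ex[OF ne[OF that]] unfolding j_def by auto
  define v where "v K = proj n \<sigma> \<tau> (j K, 0, 0)" for K
  define C where
    "C = {K \<in> components n \<sigma> \<tau>. \<not> (\<exists>u\<in>angular_cone_points n \<sigma> \<tau>. lies_on u K)}"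
  have vl: "lies_on (v K) K" if "K \<in> components n \<sigma> \<tau>" for K
    using lies[OF that j(1)[OF that]] by (simp add: v_def)
  have uniq: "K = L"
    if "K \<in> components n \<sigma> \<tau>" "L \<in> components n \<sigma> \<tau>" "lies_on (v L) K" for K L
  proof (rule disj)
    show "j L \<in> K"
      using that(3) self[of "(j L, 0, 0)"] unfolding lies_on_def v_def by force
    show "j L \<in> L" using j that by blast
  qed (use that in auto)
  have "marking n \<sigma> \<tau> (v ` C)"
    unfolding marking_def
  proof (intro conjI ballI)
    show "v ` C \<subseteq> vertices n \<sigma> \<tau>"
      using j unfolding C_def v_def vertices_def by auto
  next
    fix K assume K: "K \<in> components n \<sigma> \<tau>"
    show "if \<exists>u\<in>angular_cone_points n \<sigma> \<tau>. lies_on u K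
          then \<not> (\<exists>u\<in>v ` C. lies_on u K) else \<exists>!u. u \<in> v ` C \<and> lies_on u K"
    proof (cases "K \<in> C")
      case True
      then have "\<exists>!u. u \<in> v ` C \<and> lies_on u K"
        using vl[OF K] uniq[OF K] by (intro ex1I[of _ "v K"]) (auto simp: C_def)
      then show ?thesis using True unfolding C_def by auto
    next
      case False
      then have "\<not> (\<exists>u\<in>v ` C. lies_on u K)"
        using uniq[OF K] unfolding C_def by blast
      then show ?thesis using False K unfolding C_def by auto
    qed
  qed
  then show ?thesis by blast
qed

definition cone_points ::
    "nat \<Rightarrow> (nat \<Rightarrow> nat) \<Rightarrow> (nat \<Rightarrow> nat) \<Rightarrow> surface_point set \<Rightarrow> surface_point set" where
  "cone_points n \<sigma> \<tau> M = angular_cone_points n \<sigma> \<tau> \<union> M"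

text \<open>
  Let \<open>f\<close> be a map from a neighbourhood of \<open>p\<close> in the plane to the surface. It is a horizontal
  isometry at \<open>p\<close> if, near \<open>p\<close>, it is one and the same orthogonal map \<open>A\<close> in the
  coordinates of every closed square that contains the image point \<open>f p\<close>, and \<open>A\<close> takes the
  horizontal direction to itself up to sign. There is a pair \<open>(j, q)\<close> in \<open>f p\<close> for each corner
  or side of a square that meets \<open>f p\<close>, so that for a point of angle \<open>2 * pi\<close> the squares fit
  together to a full Euclidean disc; for a larger angle no such \<open>f\<close> exists.
\<close>

definition horizontal_isometry_at ::
    "nat \<Rightarrow> (nat \<Rightarrow> nat) \<Rightarrow> (nat \<Rightarrow> nat) \<Rightarrow> (real \<times> real \<Rightarrow> surface_point) \<Rightarrow> real \<times> real \<Rightarrow> bool" where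
  "horizontal_isometry_at n \<sigma> \<tau> f p \<longleftrightarrow>
     (\<exists>A \<epsilon>. orthogonal_transformation A \<and> snd (A (1, 0)) = 0 \<and> \<epsilon> > 0 \<and>
        (\<forall>(j, q)\<in>f p. \<forall>w. norm w < \<epsilon> \<and> q + A w \<in> unit_square \<longrightarrow>
           f (p + w) = proj n \<sigma> \<tau> (j, q + A w)))"

text \<open>
  Maps on \<open>(\<real>/c\<int>) \<times> (0, h)\<close> are represented by maps on the strip \<open>\<real> \<times> (0, h)\<close> with period
  \<open>c\<close> in the first coordinate. As usual for flat surfaces, an isometric embedding is an injective
  local isometry; it need not preserve the distances of far away points.
\<close>

definition cylinder_embedding ::
    "nat \<Rightarrow> (nat \<Rightarrow> nat) \<Rightarrow> (nat \<Rightarrow> nat) \<Rightarrow> real \<Rightarrow> real \<Rightarrow> (real \<times> real \<Rightarrow> surface_point) \<Rightarrow> bool" where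
  "cylinder_embedding n \<sigma> \<tau> c h f \<longleftrightarrow>
     f ` (UNIV \<times> {0<..<h}) \<subseteq> surface n \<sigma> \<tau> \<and>
     (\<forall>x x'. \<forall>y\<in>{0<..<h}. \<forall>y'\<in>{0<..<h}.
        f (x, y) = f (x', y') \<longleftrightarrow> y = y' \<and> (\<exists>m::int. x' - x = of_int m * c)) \<and>
     (\<forall>p\<in>UNIV \<times> {0<..<h}. horizontal_isometry_at n \<sigma> \<tau> f p)"

definition horizontal_cylinder ::
    "nat \<Rightarrow> (nat \<Rightarrow> nat) \<Rightarrow> (nat \<Rightarrow> nat) \<Rightarrow> real \<Rightarrow> real \<Rightarrow> surface_point set \<Rightarrow> bool" where
  "horizontal_cylinder n \<sigma> \<tau> c h Z \<longleftrightarrow> c > 0 \<and> h > 0 \<and>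
     (\<exists>f. cylinder_embedding n \<sigma> \<tau> c h f \<and> Z = f ` (UNIV \<times> {0<..<h}))"

definition free_horizontal_cylinder ::
    "nat \<Rightarrow> (nat \<Rightarrow> nat) \<Rightarrow> (nat \<Rightarrow> nat) \<Rightarrow> surface_point set \<Rightarrow> surface_point set \<Rightarrow> bool" where
  "free_horizontal_cylinder n \<sigma> \<tau> M Z \<longleftrightarrow>
     (\<exists>c h. horizontal_cylinder n \<sigma> \<tau> c h Z) \<and> Z \<inter> cone_points n \<sigma> \<tau> M = {}"

definition maximal_horizontal_cylinder ::
    "nat \<Rightarrow> (nat \<Rightarrow> nat) \<Rightarrow> (nat \<Rightarrow> nat) \<Rightarrow> surface_point set \<Rightarrow> surface_point set \<Rightarrow> bool" where
  "maximal_horizontal_cylinder n \<sigma> \<tau> M Z \<longleftrightarrow>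
     free_horizontal_cylinder n \<sigma> \<tau> M Z \<and>
     (\<forall>Z'. free_horizontal_cylinder n \<sigma> \<tau> M Z' \<and> Z \<subseteq> Z' \<longrightarrow> Z' = Z)"

definition single_banded ::
    "nat \<Rightarrow> (nat \<Rightarrow> nat) \<Rightarrow> (nat \<Rightarrow> nat) \<Rightarrow> surface_point set \<Rightarrow> bool" where
  "single_banded n \<sigma> \<tau> M \<longleftrightarrow>
     (\<forall>Z. maximal_horizontal_cylinder n \<sigma> \<tau> M Z \<longrightarrow>
        (\<exists>k::nat. horizontal_cylinder n \<sigma> \<tau> (real k) 1 Z))"

definition sym_group :: "nat \<Rightarrow> (nat \<Rightarrow> nat) set" where
  "sym_group n = {\<pi>. \<pi> permutes {1..n}}"

text \<open>
  The parameter \<open>mk\<close> chooses the marked vertices of each surface.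
\<close>

definition prob_single_banded ::
    "(nat \<Rightarrow> (nat \<Rightarrow> nat) \<Rightarrow> (nat \<Rightarrow> nat) \<Rightarrow> surface_point set) \<Rightarrow> nat \<Rightarrow> real" where
  "prob_single_banded mk n =
     measure_pmf.prob (pmf_of_set (sym_group n \<times> sym_group n))
       {(\<sigma>, \<tau>). single_banded n \<sigma> \<tau> (mk n \<sigma> \<tau>)}"

end

theory Submission imports Defs begin

text \<open>
  A cycle of \<open>\<sigma>\<close> is a horizontal band of squares. The surface can fail to be single-banded only if
  a cylinder extends across the horizontal line on top of some band, and then this line carries no
  cone point. The vertex at the top right corner of the square \<open>j\<close> touches the squares
  \<open>\<tau> (\<sigma> j)\<close> and \<open>\<sigma> (\<tau> j)\<close>, and it is a cone point as soon as these differ. So if the surface is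
  not single-banded, then \<open>\<tau>\<close> commutes with \<open>\<sigma>\<close> on some cycle of \<open>\<sigma>\<close>, and \<open>\<tau>\<close> is determined on
  this cycle by its value at one element (\<open>single_banded_or_equivariant\<close>).

  Such pairs are rare. Cycles of length one and two are counted together with the constraints that
  they put on \<open>\<sigma>\<close>; for a longer cycle the \<open>n\<close> starting points and the \<open>n\<close> values of \<open>\<tau>\<close> there are
  outweighed by the three values of \<open>\<tau>\<close> that get determined. Each case has probability \<open>O(1 / n)\<close>,
  and the sum is at most \<open>10 / n\<close> (\<open>prob_equivariant_pairs_le\<close>).

  The geometric half has to control arbitrary embeddings of cylinders, which are only known to be
  isometries locally. Each band is unrolled to a chart on the strip \<open>\<real> \<times> [0, 1]\<close>. Near each point an
  embedded cylinder is a chart composed with reflections (\<open>horizontal_isometry_chart\<close>), and charts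
  that meet outside the vertices differ by a translation (\<open>chart_eqD\<close>). By connectedness, an
  embedding whose image meets a top side covers the whole leaf there (\<open>leaf_through_top\<close>), and one
  whose image meets none stays inside one band (\<open>cylinder_in_band\<close>).
\<close>

section \<open>Counting pairs with an equivariant orbit\<close>

text \<open>
  If one permutation \<open>\<rho>\<close> has the prescribed values, then \<open>\<pi> \<mapsto> \<rho>\<inverse> \<circ> \<pi>\<close> maps all of them
  injectively to permutations that fix \<open>A\<close> pointwise.
\<close>

lemma card_permutes_agree_le:
  assumes S: "finite S" and A: "A \<subseteq> S"
  shows "card {\<pi>. \<pi> permutes S \<and> (\<forall>x\<in>A. \<pi> x = f x)} \<le> fact (card S - card A)"
proof (cases "{\<pi>. \<pi> permutes S \<and> (\<forall>x\<in>A. \<pi> x = f x)} = {}")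
  case True
  show ?thesis unfolding True by simp
next
  case False
  then obtain \<rho> where \<rho>: "\<rho> permutes S" "\<And>x. x \<in> A \<Longrightarrow> \<rho> x = f x" by blast
  let ?E = "{\<pi>. \<pi> permutes S \<and> (\<forall>x\<in>A. \<pi> x = f x)}"
  have inv: "inv \<rho> permutes S" using \<rho>(1) by (rule permutes_inv)
  have "inj_on (\<lambda>\<pi>. inv \<rho> \<circ> \<pi>) ?E"
  proof (rule inj_on_inverseI)
    fix \<pi>
    show "\<rho> \<circ> (inv \<rho> \<circ> \<pi>) = \<pi>" using permutes_inv_o(1)[OF \<rho>(1)] by (simp add: o_assoc)
  qed
  moreover have "(\<lambda>\<pi>. inv \<rho> \<circ> \<pi>) ` ?E \<subseteq> {\<pi>. \<pi> permutes (S - A)}"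
  proof safe
    fix \<pi> assume \<pi>: "\<pi> permutes S" "\<forall>x\<in>A. \<pi> x = f x"
    have "inv \<rho> \<circ> \<pi> permutes S" using \<pi>(1) inv by (rule permutes_compose)
    moreover have "(inv \<rho> \<circ> \<pi>) x = x" if "x \<in> A" for x
      using \<pi>(2)[rule_format, OF that] \<rho>(2)[OF that] permutes_inverses(2)[OF \<rho>(1), of x] by simp
    ultimately show "inv \<rho> \<circ> \<pi> permutes (S - A)"
      unfolding permutes_def by blast
  qed
  moreover have "finite {\<pi>. \<pi> permutes (S - A)}" using S by (simp add: finite_permutations)
  ultimately have "card ?E \<le> card {\<pi>. \<pi> permutes (S - A)}"
    by (rule card_inj_on_le)
  also have "\<dots> = fact (card S - card A)"
    using S A by (simp add: card_permutations card_Diff_subset finite_subset)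
  finally show ?thesis .
qed

text \<open>
  The combinatorial obstruction: along the orbit of \<open>j\<close>, \<open>\<tau>\<close> maps the cycle of \<open>\<sigma>\<close> through \<open>j\<close>
  to the one through \<open>\<tau> j\<close> without disturbing the cyclic order. Geometrically, all squares above
  the band of \<open>j\<close> lie in a single band, glued to it by a rotation.
\<close>

definition equivariant_orbit :: "(nat \<Rightarrow> nat) \<Rightarrow> (nat \<Rightarrow> nat) \<Rightarrow> nat \<Rightarrow> bool" where
  "equivariant_orbit \<sigma> \<tau> j \<longleftrightarrow> (\<forall>i. \<tau> ((\<sigma> ^^ i) j) = (\<sigma> ^^ i) (\<tau> j))"

definition equivariant_pairs :: "nat \<Rightarrow> ((nat \<Rightarrow> nat) \<times> (nat \<Rightarrow> nat)) set" where
  "equivariant_pairs n =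
     {(\<sigma>, \<tau>) \<in> sym_group n \<times> sym_group n. \<exists>j\<in>{1..n}. equivariant_orbit \<sigma> \<tau> j}"

lemma finite_sym_group: "finite (sym_group n)"
  by (simp add: sym_group_def finite_permutations)

lemma card_sym_group: "card (sym_group n) = fact n"
  by (simp add: sym_group_def card_permutations)

lemma sym_group_agree_le:
  assumes "A \<subseteq> {1..n}"
  shows "card {\<pi> \<in> sym_group n. \<forall>x\<in>A. \<pi> x = f x} \<le> fact (n - card A)"
  using card_permutes_agree_le[of "{1..n}" A f] assms by (simp add: sym_group_def)

lemma sym_group_closed:
  assumes "\<pi> \<in> sym_group n" "j \<in> {1..n}"
  shows "\<pi> j \<in> {1..n}"
  using assms by (simp only: sym_group_def mem_Collect_eq permutes_in_image)

lemma card_UN_le_mult: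
  assumes I: "finite I" and le: "\<And>i. i \<in> I \<Longrightarrow> card (A i) \<le> b"
  shows "card (\<Union>i\<in>I. A i) \<le> card I * b"
proof -
  have "card (\<Union>i\<in>I. A i) \<le> (\<Sum>i\<in>I. card (A i))" using I by (rule card_UN_le)
  also have "\<dots> \<le> (\<Sum>i\<in>I. b)" using le by (rule sum_mono)
  finally show ?thesis by simp
qed

lemma finite_distinct_pairs:
  fixes n :: nat
  shows "finite {(j, k). j \<in> {1..n} \<and> k \<in> {1..n} \<and> j \<noteq> k}"
  by (rule finite_subset[of _ "{1..n} \<times> {1..n}"]) auto

lemma card_distinct_pairs_le:
  fixes n :: nat
  shows "card {(j, k). j \<in> {1..n} \<and> k \<in> {1..n} \<and> j \<noteq> k} \<le> n * n"
proof -
  have "card {(j, k). j \<in> {1..n} \<and> k \<in> {1..n} \<and> j \<noteq> k} \<le> card ({1..n} \<times> {1..n})"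
    by (rule card_mono) auto
  then show ?thesis by (simp add: card_cartesian_product)
qed

text \<open>
  If \<open>\<sigma>\<close> fixes \<open>j\<close>, then equivariance makes \<open>\<tau> j\<close> a fixed point of \<open>\<sigma>\<close> too. This second constraint
  on \<open>\<sigma>\<close> has to be counted: without it the \<open>n\<close> choices of \<open>\<tau> j\<close> would give the trivial bound \<open>1\<close> for the
  probability. The first summand counts \<open>\<tau> j = j\<close>, the second one \<open>\<tau> j \<noteq> j\<close>.
\<close>

lemma card_fixed_point_pairs_le:
  "card {(\<sigma>, \<tau>) \<in> sym_group n \<times> sym_group n. \<exists>j\<in>{1..n}. \<sigma> j = j \<and> \<sigma> (\<tau> j) = \<tau> j}
     \<le> n * (fact (n - 1) * fact (n - 1)) + n * n * (fact (n - 2) * fact (n - 1))" (is "card ?B \<le> _")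
proof -
  let ?N = "{1..n}"
  define fixing where "fixing A = {\<pi> \<in> sym_group n. \<forall>x\<in>A. \<pi> x = x}" for A
  define sending where "sending j k = {\<pi> \<in> sym_group n. \<forall>x\<in>{j}. \<pi> x = k}" for j k
  have fix1: "card (fixing A) \<le> fact (n - card A)" if "A \<subseteq> ?N" for A
    unfolding fixing_def by (rule sym_group_agree_le[OF that])
  have send1: "card (sending j k) \<le> fact (n - 1)" if "j \<in> ?N" for j k
    unfolding sending_def using sym_group_agree_le[of "{j}" n "\<lambda>_. k"] that by simp
  have fin: "finite (fixing A)" "finite (sending j k)" for A j k
    unfolding fixing_def sending_def by (auto intro: finite_subset[OF _ finite_sym_group[of n]])
  let ?D = "\<Union>j\<in>?N. fixing {j} \<times> sending j j"
  let ?P = "{(j, k). j \<in> ?N \<and> k \<in> ?N \<and> j \<noteq> k}"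
  let ?O = "\<Union>(j, k)\<in>?P. fixing {j, k} \<times> sending j k"
  have P: "finite ?P" "card ?P \<le> n * n"
    by (rule finite_distinct_pairs, rule card_distinct_pairs_le)
  have "?B \<subseteq> ?D \<union> ?O"
  proof safe
    fix \<sigma> \<tau> j assume st: "\<sigma> \<in> sym_group n" "\<tau> \<in> sym_group n" and j: "j \<in> ?N"
      and h: "\<sigma> j = j" "\<sigma> (\<tau> j) = \<tau> j" and no: "(\<sigma>, \<tau>) \<notin> ?O"
    have mem: "\<sigma> \<in> fixing {j, \<tau> j}" "\<tau> \<in> sending j (\<tau> j)"
      using st h by (simp_all add: fixing_def sending_def)
    have "\<tau> j = j"
    proof (rule ccontr)
      assume "\<tau> j \<noteq> j"
      then have "(j, \<tau> j) \<in> ?P" using sym_group_closed[OF st(2) j] j by simp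
      then show False using mem no by blast
    qed
    then show "(\<sigma>, \<tau>) \<in> ?D" using mem j by auto
  qed
  then have "card ?B \<le> card (?D \<union> ?O)"
    using P(1) fin by (intro card_mono) auto
  also have "\<dots> \<le> card ?D + card ?O" by (rule card_Un_le)
  also have "card ?D \<le> card ?N * (fact (n - 1) * fact (n - 1))"
  proof (rule card_UN_le_mult)
    fix j assume "j \<in> ?N"
    then show "card (fixing {j} \<times> sending j j) \<le> fact (n - 1) * fact (n - 1)"
      using fix1[of "{j}"] send1[of j j] by (simp add: card_cartesian_product mult_le_mono)
  qed simp
  also have "card ?O \<le> card ?P * (fact (n - 2) * fact (n - 1))"
  proof (rule card_UN_le_mult[OF P(1)])
    fix q assume "q \<in> ?P"
    then obtain j k where q: "q = (j, k)" "j \<in> ?N" "k \<in> ?N" "j \<noteq> k" by auto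
    have "card (fixing {j, k}) \<le> fact (n - 2)" using fix1[of "{j, k}"] q by (simp add: numeral_2_eq_2)
    then show "card (case q of (j, k) \<Rightarrow> fixing {j, k} \<times> sending j k) \<le> fact (n - 2) * fact (n - 1)"
      using send1[of j k] q by (simp add: card_cartesian_product mult_le_mono)
  qed
  also have "card ?P * (fact (n - 2) * fact (n - 1)) \<le> n * n * (fact (n - 2) * fact (n - 1))"
    using P(2) by (rule mult_le_mono1)
  finally show ?thesis by simp
qed

text \<open>
  If \<open>j\<close> lies on a cycle of length two, then for each of the at most \<open>n\<^sup>2\<close> choices of \<open>j\<close> and \<open>\<sigma> j\<close>, both values of \<open>\<sigma>\<close> on
  the orbit are known, and the value \<open>\<tau> j\<close> determines \<open>\<tau> (\<sigma> j)\<close>.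
\<close>

lemma card_two_cycle_pairs_le:
  "card {(\<sigma>, \<tau>) \<in> sym_group n \<times> sym_group n.
            \<exists>j\<in>{1..n}. \<sigma> j \<noteq> j \<and> \<sigma> (\<sigma> j) = j \<and> \<tau> (\<sigma> j) = \<sigma> (\<tau> j)}
     \<le> n * n * (fact (n - 2) * (n * fact (n - 2)))" (is "card ?B \<le> _")
proof -
  let ?N = "{1..n}"
  let ?P = "{(j, k). j \<in> ?N \<and> k \<in> ?N \<and> j \<noteq> k}"
  define swapping where
    "swapping j k = {\<pi> \<in> sym_group n. \<forall>x\<in>{j, k}. \<pi> x = (if x = j then k else j)}" for j k
  define sending where
    "sending j k l m = {\<pi> \<in> sym_group n. \<forall>x\<in>{j, k}. \<pi> x = (if x = j then l else m)}" for j k l m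
  have P: "finite ?P" "card ?P \<le> n * n"
    by (rule finite_distinct_pairs, rule card_distinct_pairs_le)
  have two: "card (swapping j k) \<le> fact (n - 2)" "card (sending j k l m) \<le> fact (n - 2)"
    if "(j, k) \<in> ?P" for j k l m
  proof -
    have jk: "{j, k} \<subseteq> ?N" and c: "card {j, k} = 2" using that by auto
    show "card (swapping j k) \<le> fact (n - 2)" "card (sending j k l m) \<le> fact (n - 2)"
      unfolding swapping_def sending_def by (rule sym_group_agree_le[OF jk, unfolded c])+
  qed
  have fin: "finite (swapping j k)" "finite (sending j k l m)" for j k l m
    unfolding swapping_def sending_def by (auto intro: finite_subset[OF _ finite_sym_group[of n]])
  let ?C = "\<lambda>j k. SIGMA \<sigma>:swapping j k. \<Union>l\<in>?N. sending j k l (\<sigma> l)"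
  have "?B \<subseteq> (\<Union>(j, k)\<in>?P. ?C j k)"
  proof safe
    fix \<sigma> \<tau> j assume st: "\<sigma> \<in> sym_group n" "\<tau> \<in> sym_group n" and j: "j \<in> ?N"
      and h: "\<sigma> j \<noteq> j" "\<sigma> (\<sigma> j) = j" "\<tau> (\<sigma> j) = \<sigma> (\<tau> j)"
    have "(j, \<sigma> j) \<in> ?P" "\<tau> j \<in> ?N" using sym_group_closed st j h(1) by auto
    moreover have "\<sigma> \<in> swapping j (\<sigma> j)" using st h by (simp add: swapping_def)
    moreover have "\<tau> \<in> sending j (\<sigma> j) (\<tau> j) (\<sigma> (\<tau> j))" using st h by (simp add: sending_def)
    ultimately show "(\<sigma>, \<tau>) \<in> (\<Union>(j, k)\<in>?P. ?C j k)" by blast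
  qed
  then have "card ?B \<le> card (\<Union>(j, k)\<in>?P. ?C j k)"
    using P(1) fin by (intro card_mono) auto
  also have "\<dots> \<le> card ?P * (fact (n - 2) * (n * fact (n - 2)))"
  proof (rule card_UN_le_mult[OF P(1)])
    fix q assume "q \<in> ?P"
    then obtain j k where q: "q = (j, k)" "(j, k) \<in> ?P" by auto
    have "card (?C j k) = (\<Sum>\<sigma>\<in>swapping j k. card (\<Union>l\<in>?N. sending j k l (\<sigma> l)))"
      using fin by (intro card_SigmaI) auto
    also have "\<dots> \<le> (\<Sum>\<sigma>\<in>swapping j k. n * fact (n - 2))"
    proof (rule sum_mono)
      fix \<sigma>
      have "card (\<Union>l\<in>?N. sending j k l (\<sigma> l)) \<le> card ?N * fact (n - 2)"
        by (rule card_UN_le_mult) (use two(2)[OF q(2)] in auto)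
      then show "card (\<Union>l\<in>?N. sending j k l (\<sigma> l)) \<le> n * fact (n - 2)" by simp
    qed
    also have "\<dots> = card (swapping j k) * (n * fact (n - 2))" by simp
    also have "\<dots> \<le> fact (n - 2) * (n * fact (n - 2))"
      using two(1)[OF q(2)] by (rule mult_le_mono1)
    finally show "card (case q of (j, k) \<Rightarrow> ?C j k) \<le> fact (n - 2) * (n * fact (n - 2))"
      using q(1) by simp
  qed
  also have "\<dots> \<le> n * n * (fact (n - 2) * (n * fact (n - 2)))"
    using P(2) by (rule mult_le_mono1)
  finally show ?thesis .
qed

text \<open>
  If \<open>j\<close> lies on a cycle of length at least three, then the choice of \<open>\<tau> j\<close> determines \<open>\<tau>\<close> on three points, which is so
  restrictive that \<open>\<sigma>\<close> may be arbitrary and the rest of the orbit can be ignored; in particular no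
  sum over the orbit lengths arises.
\<close>

lemma card_long_cycle_pairs_le:
  "card {(\<sigma>, \<tau>) \<in> sym_group n \<times> sym_group n.
            \<exists>j\<in>{1..n}. \<sigma> j \<noteq> j \<and> \<sigma> (\<sigma> j) \<noteq> j \<and> \<tau> (\<sigma> j) = \<sigma> (\<tau> j) \<and> \<tau> (\<sigma> (\<sigma> j)) = \<sigma> (\<sigma> (\<tau> j))}
     \<le> fact n * (n * n * fact (n - 3))" (is "card ?B \<le> _")
proof -
  let ?N = "{1..n}"
  define sending where
    "sending \<sigma> j l = {\<pi> \<in> sym_group n. \<forall>x\<in>{j, \<sigma> j, \<sigma> (\<sigma> j)}.
        \<pi> x = (if x = j then l else if x = \<sigma> j then \<sigma> l else \<sigma> (\<sigma> l))}" for \<sigma> j l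
  have fin: "finite (sending \<sigma> j l)" for \<sigma> j l
    unfolding sending_def by (auto intro: finite_subset[OF _ finite_sym_group[of n]])
  define J where "J \<sigma> = {j \<in> ?N. \<sigma> j \<noteq> j \<and> \<sigma> (\<sigma> j) \<noteq> j}" for \<sigma> :: "nat \<Rightarrow> nat"
  have J: "finite (J \<sigma>)" "card (J \<sigma>) \<le> n" for \<sigma>
  proof -
    have "J \<sigma> \<subseteq> ?N" unfolding J_def by blast
    then show "finite (J \<sigma>)" "card (J \<sigma>) \<le> n"
      using finite_subset card_mono[of ?N "J \<sigma>"] by auto
  qed
  let ?C = "\<lambda>\<sigma>. \<Union>(j, l)\<in>J \<sigma> \<times> ?N. sending \<sigma> j l"
  have three: "\<sigma> (\<sigma> j) \<noteq> \<sigma> j" if "\<sigma> \<in> sym_group n" "\<sigma> j \<noteq> j" for \<sigma> j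
    using that permutes_inj[of \<sigma> ?N] by (auto simp: sym_group_def inj_eq)
  have "?B \<subseteq> (SIGMA \<sigma>:sym_group n. ?C \<sigma>)"
  proof safe
    fix \<sigma> \<tau> j assume st: "\<sigma> \<in> sym_group n" "\<tau> \<in> sym_group n" and j: "j \<in> ?N"
      and h: "\<sigma> j \<noteq> j" "\<sigma> (\<sigma> j) \<noteq> j" "\<tau> (\<sigma> j) = \<sigma> (\<tau> j)" "\<tau> (\<sigma> (\<sigma> j)) = \<sigma> (\<sigma> (\<tau> j))"
    have "(j, \<tau> j) \<in> J \<sigma> \<times> ?N" using sym_group_closed[OF st(2) j] j h by (simp add: J_def)
    moreover have "\<tau> \<in> sending \<sigma> j (\<tau> j)"
      using st h three[OF st(1) h(1)] by (simp add: sending_def)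
    ultimately show "\<tau> \<in> ?C \<sigma>" by blast
  qed
  then have "card ?B \<le> card (SIGMA \<sigma>:sym_group n. ?C \<sigma>)"
    using J(1) fin finite_sym_group by (intro card_mono) auto
  also have "\<dots> = (\<Sum>\<sigma>\<in>sym_group n. card (?C \<sigma>))"
    using J(1) fin finite_sym_group by (intro card_SigmaI) auto
  also have "\<dots> \<le> (\<Sum>\<sigma>\<in>sym_group n. n * n * fact (n - 3))"
  proof (rule sum_mono)
    fix \<sigma> assume s: "\<sigma> \<in> sym_group n"
    have "card (?C \<sigma>) \<le> card (J \<sigma> \<times> ?N) * fact (n - 3)"
    proof (rule card_UN_le_mult)
      fix q assume "q \<in> J \<sigma> \<times> ?N"
      then obtain j l where q: "q = (j, l)" "j \<in> J \<sigma>" by auto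
      have c: "card {j, \<sigma> j, \<sigma> (\<sigma> j)} = 3"
        using q(2) three[OF s, of j] by (simp add: J_def eq_commute[of j])
      have sub: "{j, \<sigma> j, \<sigma> (\<sigma> j)} \<subseteq> ?N"
        using q(2) sym_group_closed[OF s] by (auto simp: J_def)
      have "card (sending \<sigma> j l) \<le> fact (n - 3)"
        unfolding sending_def by (rule sym_group_agree_le[OF sub, unfolded c])
      then show "card (case q of (j, l) \<Rightarrow> sending \<sigma> j l) \<le> fact (n - 3)" using q(1) by simp
    qed (use J in auto)
    also have "\<dots> \<le> n * n * fact (n - 3)"
      using J(2)[of \<sigma>] by (simp add: card_cartesian_product)
    finally show "card (?C \<sigma>) \<le> n * n * fact (n - 3)" .
  qed
  finally show ?thesis by (simp add: card_sym_group)
qed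

text \<open>
  The four summands, divided by \<open>(n!)\<^sup>2\<close>, are at most \<open>1\<close>, \<open>3 / 2\<close>, \<open>9 / 4\<close> and \<open>9 / 2\<close> times \<open>1 / n\<close>;
  the estimates used are \<open>2 n \<le> 3 (n - 1)\<close> and \<open>n \<le> 3 (n - 2)\<close>.
\<close>

lemma factorial_sum_le:
  fixes n :: nat and X :: real
  assumes n: "n \<ge> 3"
    and count: "X \<le> real ((n * (fact (n - 1) * fact (n - 1)) + n * n * (fact (n - 2) * fact (n - 1)))
      + n * n * (fact (n - 2) * (n * fact (n - 2))) + fact n * (n * n * fact (n - 3)))"
  shows "X * real n \<le> 10 * (fact n * fact n)"
proof -
  define N a b g where "N = real n" and "a = (fact (n - 1) :: real)"
    and "b = (fact (n - 2) :: real)" and "g = (fact (n - 3) :: real)"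
  obtain m where "n = m + 3" using n by (metis add.commute le_Suc_ex)
  then have m: "n = Suc (Suc (Suc m))" by simp
  have na: "fact n = N * a" and a: "a = (N - 1) * b" and b: "b = (N - 2) * g"
    unfolding N_def a_def b_def g_def m by (simp_all add: algebra_simps)
  have N: "N \<ge> 3" using n by (simp add: N_def)
  have pos: "a > 0" "b > 0" "g > 0" by (simp_all add: a_def b_def g_def)
  have nb: "N * b \<le> 3 / 2 * a"
  proof -
    have "N * b \<le> (3 / 2 * (N - 1)) * b" using N pos(2) by (intro mult_right_mono) auto
    then show ?thesis unfolding a by (simp only: mult.assoc)
  qed
  have nng: "N * N * g \<le> 9 / 2 * a"
  proof -
    have "2 * N * N \<le> (3 * (N - 1)) * (3 * (N - 2))"
      using mult_mono[of "2 * N" "3 * (N - 1)" N "3 * (N - 2)"] N by simp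
    then have "(2 * N * N) * g \<le> ((3 * (N - 1)) * (3 * (N - 2))) * g"
      using pos(3) by (intro mult_right_mono) auto
    then show ?thesis by (simp add: a b algebra_simps)
  qed
  have "X \<le> N * (a * a) + (N * a) * (N * b) + N * ((N * b) * (N * b)) + (N * a) * (N * N * g)"
    using count
    by (simp only: of_nat_add of_nat_mult of_nat_fact na N_def[symmetric] a_def[symmetric]
        b_def[symmetric] g_def[symmetric] mult_ac)
  also have "\<dots> \<le> N * (a * a) + (N * a) * (3 / 2 * a) + N * ((3 / 2 * a) * (3 / 2 * a))
      + (N * a) * (9 / 2 * a)"
    using nb nng N pos
    by (intro add_mono mult_left_mono[of "N * b"] mult_left_mono[of "N * N * g"]
        mult_left_mono[of "_ * _" _ N] mult_mono[of "N * b" "3 / 2 * a" "N * b"] order_refl) auto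
  also have "\<dots> = 37 / 4 * (N * (a * a))" by (simp add: algebra_simps)
  also have "\<dots> \<le> 10 * (N * (a * a))" using N by (intro mult_right_mono) auto
  finally have "X * N \<le> 10 * (N * (a * a)) * N"
    using N by (intro mult_right_mono) auto
  then show "X * n \<le> 10 * (fact n * fact n)"
    by (simp only: na N_def[symmetric] mult_ac)
qed

lemma prob_equivariant_pairs_le:
  assumes n: "n \<ge> 3"
  shows "measure_pmf.prob (pmf_of_set (sym_group n \<times> sym_group n)) (equivariant_pairs n) \<le> 10 / n"
proof -
  let ?G = "sym_group n \<times> sym_group n"
  let ?B1 = "{(\<sigma>, \<tau>) \<in> ?G. \<exists>j\<in>{1..n}. \<sigma> j = j \<and> \<sigma> (\<tau> j) = \<tau> j}"
  let ?B2 = "{(\<sigma>, \<tau>) \<in> ?G. \<exists>j\<in>{1..n}. \<sigma> j \<noteq> j \<and> \<sigma> (\<sigma> j) = j \<and> \<tau> (\<sigma> j) = \<sigma> (\<tau> j)}"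
  let ?B3 = "{(\<sigma>, \<tau>) \<in> ?G. \<exists>j\<in>{1..n}. \<sigma> j \<noteq> j \<and> \<sigma> (\<sigma> j) \<noteq> j \<and>
     \<tau> (\<sigma> j) = \<sigma> (\<tau> j) \<and> \<tau> (\<sigma> (\<sigma> j)) = \<sigma> (\<sigma> (\<tau> j))}"
  have fin: "finite ?G" and ne: "?G \<noteq> {}"
    using finite_sym_group card_sym_group[of n] by auto
  have sub: "equivariant_pairs n \<subseteq> ?B1 \<union> ?B2 \<union> ?B3"
  proof
    fix z assume "z \<in> equivariant_pairs n"
    then obtain \<sigma> \<tau> j where z: "z = (\<sigma>, \<tau>)" "(\<sigma>, \<tau>) \<in> ?G" "j \<in> {1..n}"
      and eq: "equivariant_orbit \<sigma> \<tau> j" by (auto simp: equivariant_pairs_def)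
    have 1: "\<tau> (\<sigma> j) = \<sigma> (\<tau> j)"
      using eq[unfolded equivariant_orbit_def, rule_format, of 1] by simp
    have 2: "\<tau> (\<sigma> (\<sigma> j)) = \<sigma> (\<sigma> (\<tau> j))"
      using eq[unfolded equivariant_orbit_def, rule_format, of 2] by (simp add: numeral_2_eq_2)
    consider "\<sigma> j = j" | "\<sigma> j \<noteq> j" "\<sigma> (\<sigma> j) = j" | "\<sigma> j \<noteq> j" "\<sigma> (\<sigma> j) \<noteq> j" by blast
    then show "z \<in> ?B1 \<union> ?B2 \<union> ?B3"
    proof cases
      case 1
      then have "z \<in> ?B1" using z \<open>\<tau> (\<sigma> j) = \<sigma> (\<tau> j)\<close> by auto
      then show ?thesis by blast
    next
      case 2
      then have "z \<in> ?B2" using z 1 by auto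
      then show ?thesis by blast
    next
      case 3
      then have "z \<in> ?B3" using z 1 2 by auto
      then show ?thesis by blast
    qed
  qed
  have "card (equivariant_pairs n) \<le> card (?B1 \<union> ?B2 \<union> ?B3)"
    using sub by (rule card_mono[rotated]) (auto intro: finite_subset[OF _ fin])
  also have "\<dots> \<le> card ?B1 + card ?B2 + card ?B3"
    using card_Un_le[of "?B1 \<union> ?B2" ?B3] card_Un_le[of ?B1 ?B2] by linarith
  also have "\<dots> \<le> (n * (fact (n - 1) * fact (n - 1)) + n * n * (fact (n - 2) * fact (n - 1)))
      + n * n * (fact (n - 2) * (n * fact (n - 2))) + fact n * (n * n * fact (n - 3))"
    using card_fixed_point_pairs_le[of n] card_two_cycle_pairs_le[of n] card_long_cycle_pairs_le[of n]
    by linarith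
  finally have count: "real (card (equivariant_pairs n))
     \<le> real ((n * (fact (n - 1) * fact (n - 1)) + n * n * (fact (n - 2) * fact (n - 1)))
      + n * n * (fact (n - 2) * (n * fact (n - 2))) + fact n * (n * n * fact (n - 3)))"
    by (rule of_nat_mono)
  have "real (card (equivariant_pairs n)) * real n \<le> 10 * (fact n * fact n)"
    using n count by (rule factorial_sum_le)
  then have "real (card (equivariant_pairs n)) / (fact n * fact n) \<le> 10 / n"
    using n by (simp add: divide_le_eq pos_le_divide_eq)
  moreover have "?G \<inter> equivariant_pairs n = equivariant_pairs n"
    by (auto simp: equivariant_pairs_def)
  ultimately show ?thesis
    using measure_pmf_of_set[OF ne fin, of "equivariant_pairs n"]
    by (simp add: card_cartesian_product card_sym_group)
qed

section \<open>Rows of squares and their horizontal charts\<close>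

locale square_gluing =
  fixes n :: nat and \<sigma> \<tau> :: "nat \<Rightarrow> nat"
  assumes sigma: "\<sigma> permutes {1..n}" and tau: "\<tau> permutes {1..n}"
begin

abbreviation "point \<equiv> proj n \<sigma> \<tau>"

lemma sigma_mem: "j \<in> {1..n} \<Longrightarrow> \<sigma> j \<in> {1..n}"
  using permutes_in_image[OF sigma] by blast

lemma tau_mem: "j \<in> {1..n} \<Longrightarrow> \<tau> j \<in> {1..n}"
  using permutes_in_image[OF tau] by blast

lemma sigma_inject: "\<sigma> i = \<sigma> j \<longleftrightarrow> i = j"
  using permutes_inj[OF sigma] by (simp add: inj_eq)

lemma tau_inject: "\<tau> i = \<tau> j \<longleftrightarrow> i = j"
  using permutes_inj[OF tau] by (simp add: inj_eq)

lemma tau_surj: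
  assumes "j \<in> {1..n}"
  obtains i where "i \<in> {1..n}" "\<tau> i = j"
  using assms permutes_image[OF tau] by (metis imageE)

lemma sym_identified: "sym (identified n \<sigma> \<tau>)"
  unfolding identified_def by (rule sym_rtrancl) (auto simp: sym_def)

lemma self_mem_point: "p \<in> point p"
  by (simp add: proj_def identified_def)

lemma point_eqI:
  assumes "q \<in> point p"
  shows "point q = point p"
proof -
  have "(p, q) \<in> identified n \<sigma> \<tau>" "(q, p) \<in> identified n \<sigma> \<tau>"
    using assms sym_identified by (auto simp: proj_def dest: symD)
  then show ?thesis
    unfolding proj_def identified_def by (auto intro: rtrancl_trans)
qed

lemma point_right_side:
  assumes "j \<in> {1..n}" "y \<in> {0..1}"
  shows "point (j, 1, y) = point (\<sigma> j, 0, y)"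
proof -
  have "(\<sigma> j, 0, y) \<in> point (j, 1, y)"
    using assms by (auto simp: proj_def identified_def gluing_def intro!: r_into_rtrancl)
  then show ?thesis by (rule point_eqI[symmetric])
qed

lemma point_top_side:
  assumes "j \<in> {1..n}" "x \<in> {0..1}"
  shows "point (j, x, 1) = point (\<tau> j, x, 0)"
proof -
  have "(\<tau> j, x, 0) \<in> point (j, x, 1)"
    using assms by (auto simp: proj_def identified_def gluing_def intro!: r_into_rtrancl)
  then show ?thesis by (rule point_eqI[symmetric])
qed

text \<open>
  The tool for computing points of the surface: a set that is invariant under the gluing of sides
  contains the whole identification class of each of its elements.
\<close>

lemma point_subset:
  assumes "p \<in> S"
    and horizontal: "\<And>j y. j \<in> {1..n} \<Longrightarrow> y \<in> {0..1} \<Longrightarrow> (j, 1, y) \<in> S \<longleftrightarrow> (\<sigma> j, 0, y) \<in> S"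
    and vertical: "\<And>j x. j \<in> {1..n} \<Longrightarrow> x \<in> {0..1} \<Longrightarrow> (j, x, 1) \<in> S \<longleftrightarrow> (\<tau> j, x, 0) \<in> S"
  shows "point p \<subseteq> S"
proof
  fix q assume "q \<in> point p"
  then have "(p, q) \<in> (gluing n \<sigma> \<tau> \<union> (gluing n \<sigma> \<tau>)\<inverse>)\<^sup>*"
    by (simp add: proj_def identified_def)
  then show "q \<in> S"
  proof (induction rule: rtrancl_induct)
    case base
    show ?case by (rule assms(1))
  next
    case (step y z)
    then show ?case using horizontal vertical by (auto simp: gluing_def)
  qed
qed

text \<open>
  A row lists a cycle of \<open>\<sigma>\<close> as a sequence that is infinite in both directions, that is, it unrolls
  the band of squares to the universal cover. Indexing by the integers keeps the inverse of \<open>\<sigma>\<close>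
  and the length of the cycle out of the arguments about leaves.
\<close>

definition row :: "(int \<Rightarrow> nat) \<Rightarrow> bool" where
  "row J \<longleftrightarrow> (\<forall>m. J m \<in> {1..n} \<and> J (m + 1) = \<sigma> (J m))"

text \<open>
  The unrolled band, parametrised by the strip \<open>\<real> \<times> [0, 1]\<close>. For fixed \<open>y\<close> it runs along a
  horizontal leaf with unit speed.
\<close>

definition chart :: "(int \<Rightarrow> nat) \<Rightarrow> real \<Rightarrow> real \<Rightarrow> surface_point" where
  "chart J u y = point (J \<lfloor>u\<rfloor>, frac u, y)"

lemma rowD: "row J \<Longrightarrow> J m \<in> {1..n}" "row J \<Longrightarrow> J (m + 1) = \<sigma> (J m)"
  by (auto simp: row_def)

lemma row_exists:
  assumes j: "j \<in> {1..n}"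
  obtains J where "row J" "J 0 = j"
proof
  define J where "J m = (if m \<ge> 0 then (\<sigma> ^^ nat m) j else (inv \<sigma> ^^ nat (- m)) j)" for m :: int
  have fwd: "(\<sigma> ^^ k) j \<in> {1..n}" for k
    using j by (induction k) (simp_all add: sigma_mem del: atLeastAtMost_iff One_nat_def)
  have bwd: "(inv \<sigma> ^^ k) j \<in> {1..n}" for k
    using j by (induction k)
      (simp_all add: permutes_in_image[OF permutes_inv[OF sigma]] del: atLeastAtMost_iff One_nat_def)
  have "J (m + 1) = \<sigma> (J m)" for m
  proof (cases "m \<ge> 0")
    case True
    then show ?thesis by (simp add: J_def nat_add_distrib)
  next
    case False
    then have k: "nat (- m) = Suc (nat (- m - 1))" by simp
    have "(inv \<sigma> ^^ nat (- m)) j = inv \<sigma> ((inv \<sigma> ^^ nat (- m - 1)) j)"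
      unfolding k by simp
    moreover have "J (m + 1) = (inv \<sigma> ^^ nat (- m - 1)) j"
      using False by (cases "m = - 1") (auto simp: J_def)
    ultimately show ?thesis using False permutes_inverses(1)[OF sigma] by (simp add: J_def)
  qed
  then show "row J" using fwd bwd by (simp add: row_def J_def)
  show "J 0 = j" by (simp add: J_def)
qed

lemma row_determined:
  assumes J: "row J" and J': "row J'" and eq: "J a = J' b"
  shows "J (a + d) = J' (b + d)"
proof (induction d rule: int_induct[where k = 0])
  case base
  show ?case using eq by simp
next
  case (step1 d)
  then show ?case using rowD(2)[OF J, of "a + d"] rowD(2)[OF J', of "b + d"]
    by (simp add: add.assoc)
next
  case (step2 d)
  then show ?case using rowD(2)[OF J, of "a + (d - 1)"] rowD(2)[OF J', of "b + (d - 1)"]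
    by (simp add: add.assoc sigma_inject)
qed

text \<open>
  The number \<open>k\<close> is the length of the cycle and will be the circumference of the band.
\<close>

lemma row_period:
  assumes J: "row J"
  obtains k :: nat where "k > 0" "\<And>a b. J a = J b \<longleftrightarrow> int k dvd b - a"
proof -
  have "\<not> inj J"
  proof
    assume "inj J"
    moreover have "finite (range J)"
      by (rule finite_subset[of _ "{1..n}"]) (use rowD(1)[OF J] in blast, simp)
    ultimately show False using finite_imageD infinite_UNIV_int by blast
  qed
  then obtain a b where "J a = J b" "a < b" unfolding inj_def by (metis linorder_neq_iff)
  then have "J (a + - a) = J (b + - a)" by (intro row_determined[OF J J])
  then have ex: "nat (b - a) > 0 \<and> J (int (nat (b - a))) = J 0" using \<open>a < b\<close> by simp
  define k where "k = (LEAST k. k > 0 \<and> J (int k) = J 0)"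
  have k: "k > 0" "J (int k) = J 0" using LeastI[of "\<lambda>k. k > 0 \<and> J (int k) = J 0", OF ex]
    by (auto simp: k_def)
  have minimal: "k \<le> l" if "l > 0" "J (int l) = J 0" for l
    unfolding k_def using that by (intro Least_le) simp
  have multiple: "J (d + m * int k) = J d" for d m
  proof (induction m rule: int_induct[where k = 0])
    case (step1 m)
    have "J (0 + (d + m * int k)) = J (int k + (d + m * int k))"
      using k(2) by (intro row_determined[OF J J]) simp
    then show ?case using step1 by (simp add: algebra_simps)
  next
    case (step2 m)
    have "J (0 + (d + (m - 1) * int k)) = J (int k + (d + (m - 1) * int k))"
      using k(2) by (intro row_determined[OF J J]) simp
    then show ?case using step2 by (simp add: algebra_simps)
  qed simp
  show thesis
  proof
    show "k > 0" by (rule k(1))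
    fix a b
    show "J a = J b \<longleftrightarrow> int k dvd b - a"
    proof
      assume "J a = J b"
      then have "J (a + - a) = J (b + - a)" by (intro row_determined[OF J J])
      then have "J 0 = J (b - a)" by simp
      moreover have "J (b - a) = J ((b - a) mod int k)"
        using multiple[of "(b - a) mod int k" "(b - a) div int k"] by simp
      ultimately have "J (int (nat ((b - a) mod int k))) = J 0" using k(1) by simp
      moreover have "nat ((b - a) mod int k) < k" using k(1) by (simp add: nat_less_iff)
      ultimately have "nat ((b - a) mod int k) = 0"
        using minimal[of "nat ((b - a) mod int k)"] by linarith
      moreover have "(b - a) mod int k \<ge> 0" using k(1) by simp
      ultimately have "(b - a) mod int k = 0" by linarith
      then show "int k dvd b - a" by (simp add: dvd_eq_mod_eq_0)
    next
      assume "int k dvd b - a"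
      then obtain m where "b - a = int k * m" by (rule dvdE)
      then have "b = a + m * int k" by (simp add: algebra_simps)
      then show "J a = J b" using multiple by simp
    qed
  qed
qed

text \<open>
  Each square of a row may be used up to and including its right side, although the chart
  describes that side as the left side of the next square.
\<close>

lemma chart_eq_point:
  assumes J: "row J" and x: "x \<in> {0..1}" and y: "y \<in> {0..1}"
  shows "chart J (of_int m + x) y = point (J m, x, y)"
proof (cases "x = 1")
  case True
  have "\<lfloor>of_int m + (1::real)\<rfloor> = m + 1" "frac (of_int m + (1::real)) = 0"
    by (simp_all add: frac_def)
  then show ?thesis
    unfolding chart_def True using point_right_side[OF rowD(1)[OF J] y] rowD(2)[OF J] by simp
next
  case False
  then have "\<lfloor>of_int m + x\<rfloor> = m" "frac (of_int m + x) = x" using x by (auto simp: frac_def floor_eq_iff)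
  then show ?thesis unfolding chart_def by simp
qed

text \<open>
  Strictly between the top and the bottom only left and right sides are glued, so a point of the
  band lies in one square of the row, or on the common side of two consecutive ones.
\<close>

lemma chart_mem_interior:
  assumes J: "row J" and y: "0 < y" "y < 1" and mem: "(i, x, y') \<in> chart J u y"
  obtains m where "i = J m" "u = of_int m + x" "y' = y" "0 \<le> x" "x \<le> 1"
proof -
  let ?S = "{(J m, u - of_int m, y) | m. 0 \<le> u - of_int m \<and> u - of_int m \<le> 1}"
  have "chart J u y \<subseteq> ?S"
    unfolding chart_def
  proof (rule point_subset)
    show "(J \<lfloor>u\<rfloor>, frac u, y) \<in> ?S"
      using frac_lt_1[of u] frac_ge_0[of u] by (fastforce simp: frac_def)
  next
    fix j z assume j: "j \<in> {1..n}"
    show "(j, 1, z) \<in> ?S \<longleftrightarrow> (\<sigma> j, 0, z) \<in> ?S"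
    proof
      assume "(j, 1, z) \<in> ?S"
      then obtain m where "j = J m" "1 = u - of_int m" "z = y" by blast
      then have "(\<sigma> j, 0, z) = (J (m + 1), u - of_int (m + 1), y)"
        "0 \<le> u - of_int (m + 1) \<and> u - of_int (m + 1) \<le> 1"
        using rowD(2)[OF J, of m] by auto
      then show "(\<sigma> j, 0, z) \<in> ?S" by blast
    next
      assume "(\<sigma> j, 0, z) \<in> ?S"
      then obtain m where m: "\<sigma> j = J m" "0 = u - of_int m" "z = y" by blast
      have "j = J (m - 1)" using rowD(2)[OF J, of "m - 1"] m(1) by (simp add: sigma_inject)
      then have "(j, 1, z) = (J (m - 1), u - of_int (m - 1), y)"
        "0 \<le> u - of_int (m - 1) \<and> u - of_int (m - 1) \<le> 1"
        using m by auto
      then show "(j, 1, z) \<in> ?S" by blast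
    qed
  qed (use y in auto)
  then show thesis using mem that by fastforce
qed

text \<open>
  A point of a top side that is not a vertex has exactly two representatives, one at the top of
  the square below it and one at the bottom of the square above it.
\<close>

lemma chart_mem_top:
  assumes u: "u \<notin> \<int>" and mem: "(i, x, 1) \<in> chart J u 1"
  shows "i = J \<lfloor>u\<rfloor>" "x = frac u"
proof -
  have f: "frac u \<noteq> 0" "frac u \<noteq> 1"
    using u frac_lt_1[of u] by (simp_all add: frac_eq_0_iff)
  have "chart J u 1 \<subseteq> {(J \<lfloor>u\<rfloor>, frac u, 1), (\<tau> (J \<lfloor>u\<rfloor>), frac u, 0)}"
    unfolding chart_def by (rule point_subset) (use f in \<open>auto simp: tau_inject\<close>)
  then show "i = J \<lfloor>u\<rfloor>" "x = frac u" using mem by auto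
qed

text \<open>
  Rigidity: charts that meet at equal heights in one point that is not a vertex differ by an
  integer translation throughout. Every gluing of local information below rests on this.
\<close>

lemma chart_eqD:
  assumes J: "row J" and J': "row J'" and y: "0 < y" "y \<le> 1" and generic: "y < 1 \<or> u \<notin> \<int>"
    and eq: "chart J u y = chart J' u' y"
  obtains d where "u = u' + of_int d" "\<And>m. J' m = J (m + d)" "\<And>r z. chart J (u + r) z = chart J' (u' + r) z"
proof -
  have mem: "(J' \<lfloor>u'\<rfloor>, frac u', y) \<in> chart J u y"
    unfolding eq unfolding chart_def by (rule self_mem_point)
  obtain m where m: "J' \<lfloor>u'\<rfloor> = J m" "u = of_int m + frac u'"
  proof (cases "y < 1")
    case True
    then show thesis using chart_mem_interior[OF J y(1) True] mem that by metis
  next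
    case False
    then have "y = 1" "u \<notin> \<int>" using y generic by auto
    then have "J' \<lfloor>u'\<rfloor> = J \<lfloor>u\<rfloor>" "frac u' = frac u" using chart_mem_top mem by blast+
    then show thesis using that[of "\<lfloor>u\<rfloor>"] by (simp add: frac_def)
  qed
  define d where "d = m - \<lfloor>u'\<rfloor>"
  have d: "u = u' + of_int d" using m(2) by (simp add: d_def frac_def)
  have shift: "J' k = J (k + d)" for k
    using row_determined[OF J' J m(1), of "k - \<lfloor>u'\<rfloor>"] by (simp add: d_def algebra_simps)
  have "chart J (u + r) z = chart J' (u' + r) z" for r z
  proof -
    have "u + r = (u' + r) + of_int d" using d by simp
    then show ?thesis unfolding chart_def shift by (simp only: floor_add_int frac_add_of_int_right)
  qed
  with d shift show thesis by (rule that)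
qed

text \<open>
  Bottom sides are top sides of the squares below, so that integer heights occur as \<open>y = 1\<close> only.
\<close>

lemma surface_cases:
  assumes "P \<in> surface n \<sigma> \<tau>"
  obtains j t y where "P = point (j, t, y)" "j \<in> {1..n}" "t \<in> {0..1}" "0 < y" "y \<le> 1"
proof -
  obtain j t y where P: "P = point (j, t, y)" and j: "j \<in> {1..n}" "t \<in> {0..1}" "y \<in> {0..1}"
    using assms by (auto simp: surface_def squares_def unit_square_def proj_def elim!: quotientE)
  show thesis
  proof (cases "y = 0")
    case True
    obtain i where "i \<in> {1..n}" "\<tau> i = j" using tau_surj[OF j(1)] .
    then show thesis using that[of i t 1] P j True point_top_side[of i t] by simp
  next
    case False
    then show thesis using that[OF P] j by simp
  qed
qed

lemma chart_in_surface:
  assumes "row J" "y \<in> {0..1}"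
  shows "chart J u y \<in> surface n \<sigma> \<tau>"
proof -
  have "frac u \<in> {0..1}" using frac_lt_1[of u] frac_ge_0[of u] by simp
  then show ?thesis
    unfolding chart_def proj_def surface_def squares_def unit_square_def
    using rowD(1)[OF assms(1)] assms(2) by (intro quotientI) simp
qed

end

section \<open>Local form of a horizontal isometry\<close>

lemma horizontal_orthogonal_form:
  fixes A :: "real \<times> real \<Rightarrow> real \<times> real"
  assumes A: "orthogonal_transformation A" and hor: "snd (A (1, 0)) = 0"
  obtains a b where "\<bar>a\<bar> = 1" "\<bar>b\<bar> = 1" "\<And>w. A w = (a * fst w, b * snd w)"
proof -
  obtain a where a: "A (1, 0) = (a, 0)" using hor by (metis prod.collapse)
  obtain c b where b: "A (0, 1) = (c, b)" by (metis prod.collapse)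
  have n: "norm (A w) = norm w" for w using A by (rule orthogonal_transformation_norm)
  have a1: "\<bar>a\<bar> = 1" using n[of "(1, 0)"] by (simp add: a norm_Pair)
  have "inner (A (1, 0)) (A (0, 1)) = inner (1 :: real, 0 :: real) (0, 1)"
    using A by (simp only: orthogonal_transformation_def)
  then have c: "c = 0" using a1 by (auto simp: a b)
  have b1: "\<bar>b\<bar> = 1" using n[of "(0, 1)"] by (simp add: b c norm_Pair)
  have lin: "linear A" using A by (simp add: orthogonal_transformation_def)
  have "A w = (a * fst w, b * snd w)" for w
  proof -
    have "w = fst w *\<^sub>R (1, 0) + snd w *\<^sub>R (0, 1)" by (cases w) simp
    then have "A w = fst w *\<^sub>R A (1, 0) + snd w *\<^sub>R A (0, 1)"
      by (simp only: linear_add[OF lin, symmetric] linear_scale[OF lin, symmetric])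
    then show ?thesis by (simp add: a b c mult.commute)
  qed
  with a1 b1 show thesis by (rule that)
qed

text \<open>
  Vertices of a leaf have integer parameters, and an arbitrarily small shift avoids them: of two
  different shifts smaller than \<open>1\<close>, at least one leads to a number that is not an integer.
\<close>

lemma small_shift_not_Ints:
  fixes v a \<delta> :: real
  assumes a: "\<bar>a\<bar> = 1" and \<delta>: "\<delta> > 0"
  obtains r where "0 < r" "r < \<delta>" "r < 1 / 2" "v + a * r \<notin> \<int>"
proof -
  define e where "e = min \<delta> (1 / 2)"
  have e: "0 < e" "e \<le> \<delta>" "e \<le> 1 / 2" using \<delta> by (auto simp: e_def)
  have "v + a * (e / 2) \<notin> \<int> \<or> v + a * (e / 3) \<notin> \<int>"
  proof (rule ccontr)
    assume "\<not> ?thesis"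
    then have "(v + a * (e / 2)) - (v + a * (e / 3)) \<in> \<int>" by (intro Ints_diff) auto
    then have "a * (e / 6) \<in> \<int>" by (simp add: field_simps)
    then have "\<bar>a * (e / 6)\<bar> \<ge> 1" using a e by (intro Ints_nonzero_abs_ge1) auto
    then show False using a e by (simp add: abs_mult)
  qed
  then show thesis using that[of "e / 2"] that[of "e / 3"] e by auto
qed

context square_gluing
begin

text \<open>
  Near any point an embedded cylinder agrees with a chart up to reflections of the coordinates.
  On the left side of a square the two halves of the neighbourhood come from different
  representatives of the same point, in the square itself and in its left neighbour, and the
  single orthogonal map of the isometry makes them fit together.
\<close>

lemma horizontal_isometry_chart:
  assumes iso: "horizontal_isometry_at n \<sigma> \<tau> f p"
    and p: "f p = point (j, t, y)" "j \<in> {1..n}" "t \<in> {0..1}" "y \<in> {0..1}"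
  obtains J u a b \<epsilon> where "row J" "\<bar>a\<bar> = 1" "\<bar>b\<bar> = 1" "\<epsilon> > 0"
    "\<And>w. norm w < \<epsilon> \<Longrightarrow> y + b * snd w \<in> {0..1} \<Longrightarrow>
       f (p + w) = chart J (u + a * fst w) (y + b * snd w)"
proof -
  obtain i s where i: "f p = point (i, s, y)" "i \<in> {1..n}" and s: "0 \<le> s" "s < 1"
  proof (cases "t = 1")
    case True
    then show thesis using that[of "\<sigma> j" 0] p point_right_side[OF p(2,4)] sigma_mem[OF p(2)] by simp
  next
    case False
    then show thesis using that[of j t] p by simp
  qed
  obtain A \<epsilon> where A: "orthogonal_transformation A" "snd (A (1, 0)) = 0" and \<epsilon>: "\<epsilon> > 0"
    and loc: "\<And>j q w. (j, q) \<in> f p \<Longrightarrow> norm w < \<epsilon> \<Longrightarrow> q + A w \<in> unit_square \<Longrightarrow>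
                f (p + w) = point (j, q + A w)"
    using iso unfolding horizontal_isometry_at_def by blast
  obtain a b where ab: "\<bar>a\<bar> = 1" "\<bar>b\<bar> = 1" and Aw: "\<And>w. A w = (a * fst w, b * snd w)"
    by (rule horizontal_orthogonal_form[OF A]) (rule that)
  obtain J where J: "row J" "J 0 = i" using row_exists[OF i(2)] .
  define \<delta> where "\<delta> = min \<epsilon> (min (1 - s) (if s = 0 then 1 else s))"
  have "\<delta> > 0" using \<epsilon> s by (auto simp: \<delta>_def)
  have mem: "(i, s, y) \<in> f p" unfolding i(1) by (rule self_mem_point)
  have "f (p + w) = chart J (s + a * fst w) (y + b * snd w)"
    if w: "norm w < \<delta>" and yw: "y + b * snd w \<in> {0..1}" for w
  proof -
    have "\<bar>fst w\<bar> \<le> norm w" using norm_fst_le[of "fst w" "snd w"] by simp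
    then have "\<bar>a * fst w\<bar> < \<delta>" using w ab(1) by (simp add: abs_mult)
    then have small: "a * fst w < 1 - s" "- 1 < a * fst w" "s \<noteq> 0 \<Longrightarrow> - s < a * fst w"
      using s by (auto simp: \<delta>_def split: if_splits)
    have w\<epsilon>: "norm w < \<epsilon>" using w by (simp add: \<delta>_def)
    show ?thesis
    proof (cases "s + a * fst w \<ge> 0")
      case True
      have "f (p + w) = point (i, s + a * fst w, y + b * snd w)"
        using loc[OF mem w\<epsilon>] True small yw by (simp add: Aw unit_square_def)
      then show ?thesis
        using chart_eq_point[OF J(1), of "s + a * fst w" "y + b * snd w" 0] True small yw J(2) by simp
    next
      case False
      then have s0: "s = 0" using small(3) by fastforce
      have i': "\<sigma> (J (- 1)) = i" using rowD(2)[OF J(1), of "- 1"] J(2) by simp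
      have "f p = point (J (- 1), 1, y)"
        using i(1) s0 i' point_right_side[OF rowD(1)[OF J(1)] p(4), of "- 1"] by simp
      then have "(J (- 1), 1, y) \<in> f p" using self_mem_point by simp
      from loc[OF this w\<epsilon>]
      have "f (p + w) = point (J (- 1), 1 + a * fst w, y + b * snd w)"
        using False s0 small yw by (simp add: Aw unit_square_def)
      then show ?thesis
        using chart_eq_point[OF J(1), of "1 + a * fst w" "y + b * snd w" "- 1"] False small yw s0
        by simp
    qed
  qed
  then show thesis using that J(1) ab \<open>\<delta> > 0\<close> by blast
qed

section \<open>Cone points on the boundary of a band\<close>

lemma finite_vertex:
  assumes "j \<in> {1..n}"
  shows "finite (point (j, 1, 1))"
proof (rule finite_subset)
  show "point (j, 1, 1) \<subseteq> {1..n} \<times> {0, 1} \<times> {0, 1}"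
    by (rule point_subset) (use assms sigma_mem tau_mem in auto)
qed simp

text \<open>
  Walking from the corner first right and then up, or first up and then right, gives two different
  squares. The point therefore has at least five corners, and a total angle above \<open>2 * pi\<close>.
\<close>

lemma noncommuting_corner_is_cone_point:
  assumes j: "j \<in> {1..n}" and nc: "\<tau> (\<sigma> j) \<noteq> \<sigma> (\<tau> j)"
  shows "point (j, 1, 1) \<in> angular_cone_points n \<sigma> \<tau>"
proof -
  let ?V = "point (j, 1, 1)"
  let ?C = "{(j, 1, 1), (\<sigma> j, 0, 1), (\<tau> (\<sigma> j), 0, 0), (\<tau> j, 1, 0), (\<sigma> (\<tau> j), 0 :: real, 0 :: real)}"
  have "?V = point (\<sigma> j, 0, 1)" "?V = point (\<tau> (\<sigma> j), 0, 0)"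
    "?V = point (\<tau> j, 1, 0)" "?V = point (\<sigma> (\<tau> j), 0, 0)"
    using point_right_side[of j 1] point_top_side[of "\<sigma> j" 0] point_top_side[of j 1]
      point_right_side[of "\<tau> j" 0] j sigma_mem[OF j] tau_mem[OF j] by auto
  then have "?C \<subseteq> ?V" using self_mem_point by blast
  moreover have "card ?C = 5" using nc by simp
  ultimately have "card ?V \<ge> 5" using card_mono[OF finite_vertex[OF j]] by metis
  then have "4 * (pi / 2) < real (card ?V) * (pi / 2)" by (intro mult_strict_right_mono) auto
  then show ?thesis using j by (auto simp: angular_cone_points_def vertices_def total_angle_def)
qed

section \<open>A cylinder that meets a top side contains the whole leaf\<close>

text \<open>
  Rigidity at a generic point makes the two charts differ by an integer translation there. If the
  directions were opposite, a leaf would be symmetric under arbitrarily small reflections, which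
  contradicts rigidity again.
\<close>

lemma leaf_charts_agree:
  assumes J: "row J" "row J'" and a: "\<bar>a\<bar> = 1" "\<bar>a'\<bar> = 1" and \<delta>: "\<delta> > 0"
    and eq: "\<And>z. \<bar>z - x\<bar> < \<delta> \<Longrightarrow> chart J (u + a * z) 1 = chart J' (u' + a' * z) 1"
  shows "chart J (u + a * z) 1 = chart J' (u' + a' * z) 1"
proof -
  obtain r where r: "0 < r" "r < \<delta> / 2" "u + a * x + a * r \<notin> \<int>"
    using small_shift_not_Ints[of a "\<delta> / 2" "u + a * x"] a(1) \<delta> by auto
  define x1 where "x1 = x + r"
  have v: "u + a * x1 \<notin> \<int>" using r(3) by (simp add: x1_def algebra_simps)
  have "chart J (u + a * x1) 1 = chart J' (u' + a' * x1) 1"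
    using r \<delta> by (intro eq) (simp add: x1_def)
  then obtain d :: int where d: "\<And>s z. chart J (u + a * x1 + s) z = chart J' (u' + a' * x1 + s) z"
    by (rule chart_eqD[OF J zero_less_one order_refl disjI2[OF v]]) (rule that)
  have "a' = a"
  proof (rule ccontr)
    assume "a' \<noteq> a"
    then have a': "a' = - a" using a by linarith
    obtain s where s: "0 < s" "s < \<delta> / 2" "s < 1 / 2" "u + a * x1 + a * s \<notin> \<int>"
      using small_shift_not_Ints[of a "\<delta> / 2" "u + a * x1"] a(1) \<delta> by auto
    have "chart J (u + a * (x1 + s)) 1 = chart J' (u' + a' * (x1 + s)) 1"
      using r s \<delta> by (intro eq) (simp add: x1_def)
    then have "chart J (u + a * x1 + a * s) 1 = chart J' (u' + a' * x1 + (- a * s)) 1"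
      by (simp add: a' algebra_simps)
    also have "\<dots> = chart J (u + a * x1 + (- a * s)) 1" by (rule d[symmetric])
    finally obtain e where "u + a * x1 + a * s = u + a * x1 + (- a * s) + of_int e"
      by (rule chart_eqD[OF J(1) J(1) zero_less_one order_refl disjI2[OF s(4)]]) (rule that)
    then have "2 * (a * s) = of_int e" by simp
    then have "\<bar>2 * (a * s)\<bar> \<ge> 1"
      using a(1) s(1) by (intro Ints_nonzero_abs_ge1) auto
    then show False using a(1) s by (simp add: abs_mult)
  qed
  then show ?thesis using d[of "a * (z - x1)" 1] by (simp add: algebra_simps)
qed

text \<open>
  A local isometry could a priori turn back or leave the leaf at a vertex. The proof shows that
  agreement near \<open>x\<close> with one fixed chart, in one fixed direction, is locally constant in \<open>x\<close>;
  since the line is connected, it spreads from \<open>x0\<close> to the entire line.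
\<close>

lemma leaf_through_top:
  assumes emb: "cylinder_embedding n \<sigma> \<tau> c h f" and y0: "y0 \<in> {0<..<h}"
    and p: "f (x0, y0) = point (j, t, 1)" "j \<in> {1..n}" "t \<in> {0..1}"
  obtains J u a where "row J" "\<bar>a\<bar> = 1" "\<And>x. f (x, y0) = chart J (u + a * x) 1"
proof -
  have iso: "horizontal_isometry_at n \<sigma> \<tau> f (x, y0)" and surf: "f (x, y0) \<in> surface n \<sigma> \<tau>" for x
    using emb y0 unfolding cylinder_embedding_def by auto
  have leaf: "\<exists>J u a \<epsilon>. row J \<and> \<bar>a\<bar> = 1 \<and> \<epsilon> > 0 \<and>
      (\<forall>z. \<bar>z - x\<bar> < \<epsilon> \<longrightarrow> f (z, y0) = chart J (u + a * z) y)"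
    if h: "f (x, y0) = point (j, t, y)" "j \<in> {1..n}" "t \<in> {0..1}" "y \<in> {0..1}" for x j t y
  proof -
    obtain J u a b \<epsilon> where J: "row J" "\<bar>a\<bar> = 1" "\<epsilon> > 0"
      and loc: "\<And>w. norm w < \<epsilon> \<Longrightarrow> y + b * snd w \<in> {0..1} \<Longrightarrow>
         f ((x, y0) + w) = chart J (u + a * fst w) (y + b * snd w)"
      using horizontal_isometry_chart[OF iso h] by metis
    have "f (z, y0) = chart J ((u - a * x) + a * z) y" if "\<bar>z - x\<bar> < \<epsilon>" for z
      using loc[of "(z - x, 0)"] that h(4) by (simp add: norm_Pair algebra_simps)
    then show ?thesis using J by blast
  qed
  obtain J0 u0 a0 \<epsilon>0 where J0: "row J0" "\<bar>a0\<bar> = 1" "\<epsilon>0 > 0"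
    and f0: "\<And>z. \<bar>z - x0\<bar> < \<epsilon>0 \<Longrightarrow> f (z, y0) = chart J0 (u0 + a0 * z) 1"
    using leaf[OF p] by auto
  define P where "P x \<longleftrightarrow> (\<exists>\<delta>>0. \<forall>z. \<bar>z - x\<bar> < \<delta> \<longrightarrow> f (z, y0) = chart J0 (u0 + a0 * z) 1)" for x
  have Px0: "P x0" using J0(3) f0 unfolding P_def by blast
  have "P x0 = P x" for x
  proof (rule connected_local_const[of UNIV x0 x P])
    show "\<forall>x\<in>UNIV. \<forall>\<^sub>F z in at x within UNIV. P x = P z"
    proof
      fix x
      obtain j t y where q: "f (x, y0) = point (j, t, y)" "j \<in> {1..n}" "t \<in> {0..1}" and y: "0 < y" "y \<le> 1"
        using surface_cases[OF surf] .
      obtain J u a \<epsilon> where J: "row J" "\<bar>a\<bar> = 1" "\<epsilon> > 0"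
        and f: "\<And>z. \<bar>z - x\<bar> < \<epsilon> \<Longrightarrow> f (z, y0) = chart J (u + a * z) y"
        using leaf[OF q] y by auto
      \<comment> \<open>The condition \<open>?R\<close> does not mention the nearby point \<open>x'\<close>, so \<open>P\<close> is constant near \<open>x\<close>.\<close>
      let ?R = "y = 1 \<and> (\<forall>z. chart J (u + a * z) 1 = chart J0 (u0 + a0 * z) 1)"
      have "P x' \<longleftrightarrow> ?R" if x': "\<bar>x' - x\<bar> < \<epsilon>" for x'
      proof
        assume "P x'"
        then obtain \<delta>' where \<delta>': "\<delta>' > 0"
          and f': "\<And>z. \<bar>z - x'\<bar> < \<delta>' \<Longrightarrow> f (z, y0) = chart J0 (u0 + a0 * z) 1"
          unfolding P_def by blast
        define \<delta> where "\<delta> = min \<delta>' (\<epsilon> - \<bar>x' - x\<bar>)"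
        have \<delta>: "\<delta> > 0" using \<delta>' x' by (simp add: \<delta>_def)
        have eq: "chart J (u + a * z) y = chart J0 (u0 + a0 * z) 1" if "\<bar>z - x'\<bar> < \<delta>" for z
        proof -
          have "\<bar>z - x'\<bar> < \<delta>'" "\<bar>z - x'\<bar> < \<epsilon> - \<bar>x' - x\<bar>" using that by (simp_all add: \<delta>_def)
          then have "f (z, y0) = chart J0 (u0 + a0 * z) 1" "\<bar>z - x\<bar> < \<epsilon>" using f' by auto
          then show ?thesis using f by simp
        qed
        have y1: "y = 1"
        proof (rule ccontr)
          assume "y \<noteq> 1"
          then have "y < 1" using y by simp
          have eq': "chart J (u + a * x') y = chart J0 (u0 + a0 * x') 1" using eq[of x'] \<delta> by simp
          have "(J0 \<lfloor>u0 + a0 * x'\<rfloor>, frac (u0 + a0 * x'), 1) \<in> chart J (u + a * x') y"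
            unfolding eq' unfolding chart_def by (rule self_mem_point)
          from chart_mem_interior[OF J(1) y(1) \<open>y < 1\<close> this] \<open>y \<noteq> 1\<close> show False by metis
        qed
        then show ?R using leaf_charts_agree[OF J(1) J0(1) J(2) J0(2) \<delta>, of x' u u0] eq by blast
      next
        assume R: ?R
        have "f (z, y0) = chart J0 (u0 + a0 * z) 1" if "\<bar>z - x'\<bar> < \<epsilon> - \<bar>x' - x\<bar>" for z
        proof -
          have "\<bar>z - x\<bar> < \<epsilon>" using that by linarith
          then show ?thesis using f[of z] R by simp
        qed
        then show "P x'" unfolding P_def using x' by (intro exI[of _ "\<epsilon> - \<bar>x' - x\<bar>"]) auto
      qed
      then show "\<forall>\<^sub>F z in at x within UNIV. P x = P z"
        unfolding eventually_at using J(3) by (intro exI[of _ \<epsilon>]) (auto simp: dist_real_def)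
    qed
  qed auto
  then have "f (x, y0) = chart J0 (u0 + a0 * x) 1" for x
    using Px0 unfolding P_def by (metis abs_zero diff_self)
  with J0(1,2) show thesis by (rule that)
qed

section \<open>Bands are the maximal cylinders\<close>

definition band :: "(int \<Rightarrow> nat) \<Rightarrow> surface_point set" where
  "band J = {chart J u y | u y. 0 < y \<and> y < 1}"

text \<open>
  Lying in a given band is locally constant on the strip if the image avoids the top sides,
  because two bands with a common point are equal.
\<close>

lemma cylinder_in_band:
  assumes emb: "cylinder_embedding n \<sigma> \<tau> c h f" and h: "h > 0"
    and inner: "\<And>p j t. p \<in> UNIV \<times> {0<..<h} \<Longrightarrow> j \<in> {1..n} \<Longrightarrow> t \<in> {0..1} \<Longrightarrow> f p \<noteq> point (j, t, 1)"
  obtains J where "row J" "f ` (UNIV \<times> {0<..<h}) \<subseteq> band J"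
proof -
  let ?D = "(UNIV :: real set) \<times> {0<..<h}"
  have loc: "\<exists>J \<epsilon>. row J \<and> \<epsilon> > 0 \<and> (\<forall>q\<in>?D. dist q p < \<epsilon> \<longrightarrow> f q \<in> band J)" if p: "p \<in> ?D" for p
  proof -
    have "f p \<in> surface n \<sigma> \<tau>" using emb p unfolding cylinder_embedding_def by blast
    then obtain j t y where q: "f p = point (j, t, y)" "j \<in> {1..n}" "t \<in> {0..1}" and y: "0 < y" "y \<le> 1"
      using surface_cases by metis
    have y1: "y < 1" using inner[OF p q(2,3)] q(1) y by (cases "y = 1") auto
    have iso: "horizontal_isometry_at n \<sigma> \<tau> f p" using emb p unfolding cylinder_embedding_def by blast
    obtain J u a b \<epsilon> where J: "row J" "\<bar>b\<bar> = 1" "\<epsilon> > 0"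
      and f: "\<And>w. norm w < \<epsilon> \<Longrightarrow> y + b * snd w \<in> {0..1} \<Longrightarrow>
         f (p + w) = chart J (u + a * fst w) (y + b * snd w)"
      using horizontal_isometry_chart[OF iso q] y by (metis atLeastAtMost_iff less_imp_le)
    define \<delta> where "\<delta> = min \<epsilon> (min y (1 - y))"
    have "f q \<in> band J" if "dist q p < \<delta>" for q
    proof -
      define w where "w = q - p"
      have w: "norm w < \<delta>" "q = p + w" using that by (simp_all add: w_def dist_norm)
      have "\<bar>snd w\<bar> \<le> norm w" using norm_snd_le[of "snd w" "fst w"] by simp
      then have "\<bar>b * snd w\<bar> < \<delta>" using w(1) J(2) by (simp add: abs_mult)
      then have "0 < y + b * snd w" "y + b * snd w < 1" by (auto simp: \<delta>_def)
      then show ?thesis using f[of w] w unfolding band_def \<delta>_def by auto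
    qed
    moreover have "\<delta> > 0" using J(3) y y1 by (simp add: \<delta>_def)
    ultimately show ?thesis using J(1) by blast
  qed
  have p0: "(0, h / 2) \<in> ?D" using h by simp
  obtain J0 \<epsilon>0 where J0: "row J0" "\<epsilon>0 > 0" "\<And>q. q \<in> ?D \<Longrightarrow> dist q (0, h / 2) < \<epsilon>0 \<Longrightarrow> f q \<in> band J0"
    using loc[OF p0] by blast
  have band_eq: "band J = band J'" if J: "row J" "row J'" and P: "P \<in> band J" "P \<in> band J'" for J J' P
  proof -
    obtain u y u' y' where 1: "P = chart J u y" "0 < y" "y < 1" and 2: "P = chart J' u' y'" "0 < y'" "y' < 1"
      using P unfolding band_def by blast
    have eq: "chart J u y = chart J' u' y'" using 1(1) 2(1) by simp
    have "(J' \<lfloor>u'\<rfloor>, frac u', y') \<in> chart J u y"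
      unfolding eq unfolding chart_def by (rule self_mem_point)
    then have "y' = y" using chart_mem_interior[OF J(1) 1(2,3)] by metis
    with eq have "chart J u y = chart J' u' y" by simp
    then obtain d :: int where d: "\<And>r z. chart J (u + r) z = chart J' (u' + r) z"
      by (rule chart_eqD[OF J 1(2) less_imp_le[OF 1(3)] disjI1[OF 1(3)]]) (rule that)
    have *: "chart J v z = chart J' (v + (u' - u)) z" "chart J' v z = chart J (v + (u - u')) z" for v z
      using d[of "v - u" z] d[of "v - u'" z] by (simp_all add: algebra_simps)
    show ?thesis unfolding band_def using * by blast
  qed
  have "(f p0 \<in> band J0) = (f p \<in> band J0)" if "p0 \<in> ?D" "p \<in> ?D" for p0 p
  proof (rule connected_local_const[of ?D "p0" "p" "\<lambda>p. f p \<in> band J0"])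
    show "connected ?D" by (intro connected_Times connected_UNIV connected_Ioo)
    show "\<forall>p\<in>?D. \<forall>\<^sub>F q in at p within ?D. (f p \<in> band J0) = (f q \<in> band J0)"
    proof
      fix p assume p: "p \<in> ?D"
      obtain J \<epsilon> where J: "row J" "\<epsilon> > 0" and f: "\<And>q. q \<in> ?D \<Longrightarrow> dist q p < \<epsilon> \<Longrightarrow> f q \<in> band J"
        using loc[OF p] by blast
      have "(f p \<in> band J0) = (f q \<in> band J0)" if "q \<in> ?D" "dist q p < \<epsilon>" for q
        using f[OF p] f[OF that] J(2) band_eq[OF J(1) J0(1)] by auto
      then show "\<forall>\<^sub>F q in at p within ?D. (f p \<in> band J0) = (f q \<in> band J0)"
        unfolding eventually_at using J(2) by blast
    qed
  qed (use that in auto)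
  moreover have "f (0, h / 2) \<in> band J0" using J0(2) J0(3)[OF p0] by simp
  ultimately have "f ` ?D \<subseteq> band J0" using p0 by blast
  with J0(1) show thesis by (rule that)
qed

text \<open>
  The radius \<open>1\<close> suffices at every point, as the condition only concerns displacements that stay
  inside one closed square.
\<close>

lemma chart_isometry:
  assumes J: "row J" and y: "0 < y" "y < 1"
  shows "horizontal_isometry_at n \<sigma> \<tau> (\<lambda>(x, y). chart J x y) (u, y)"
  unfolding horizontal_isometry_at_def
proof (intro exI[of _ id] exI[of _ 1] conjI ballI)
  show "orthogonal_transformation (id :: real \<times> real \<Rightarrow> _)"
    using orthogonal_transformation_id by (simp add: id_def)
  fix q assume "q \<in> (\<lambda>(x, y). chart J x y) (u, y)"
  then obtain j x y' where q: "q = (j, x, y')" and mem: "(j, x, y') \<in> chart J u y" by (cases q) auto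
  from mem obtain m where m: "j = J m" "u = of_int m + x" "y' = y"
    using chart_mem_interior[OF J y] by metis
  show "case q of (j, q) \<Rightarrow> \<forall>w. norm w < 1 \<and> q + id w \<in> unit_square \<longrightarrow>
      (\<lambda>(x, y). chart J x y) ((u, y) + w) = point (j, q + id w)"
    using chart_eq_point[OF J, where m = m] by (auto simp: q m unit_square_def add.assoc)
qed auto

lemma band_is_cylinder:
  assumes J: "row J"
  obtains k :: nat where "horizontal_cylinder n \<sigma> \<tau> (real k) 1 (band J)"
proof -
  obtain k :: nat where k: "k > 0" and period: "\<And>a b. J a = J b \<longleftrightarrow> int k dvd b - a"
    using row_period[OF J] by blast
  let ?f = "\<lambda>(x, y). chart J x y"
  have "cylinder_embedding n \<sigma> \<tau> (real k) 1 ?f"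
    unfolding cylinder_embedding_def
  proof (intro conjI allI ballI)
    show "?f ` (UNIV \<times> {0<..<1}) \<subseteq> surface n \<sigma> \<tau>"
      using chart_in_surface[OF J] by auto
  next
    fix p :: "real \<times> real" assume "p \<in> UNIV \<times> {0<..<1}"
    then show "horizontal_isometry_at n \<sigma> \<tau> ?f p"
      using chart_isometry[OF J] by (cases p) auto
  next
    fix x x' y y' :: real assume y: "y \<in> {0<..<1}" "y' \<in> {0<..<1}"
    show "?f (x, y) = ?f (x', y') \<longleftrightarrow> y = y' \<and> (\<exists>m::int. x' - x = of_int m * real k)"
    proof
      assume "?f (x, y) = ?f (x', y')"
      then have eq: "chart J x y = chart J x' y'" by simp
      then have "(J \<lfloor>x\<rfloor>, frac x, y) \<in> chart J x' y'"
        using self_mem_point by (metis chart_def)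
      then have yy: "y = y'" using chart_mem_interior[OF J] y by (metis greaterThanLessThan_iff)
      obtain d where d: "x = x' + of_int d" "\<And>m. J m = J (m + d)"
        using chart_eqD[OF J J, of y x x'] y eq yy by auto
      have "int k dvd d" using d(2)[of 0] period by simp
      then obtain m where "d = int k * m" by (rule dvdE)
      then have "x' - x = of_int (- m) * real k" using d(1) by simp
      then show "y = y' \<and> (\<exists>m::int. x' - x = of_int m * real k)" using yy by blast
    next
      assume "y = y' \<and> (\<exists>m::int. x' - x = of_int m * real k)"
      then obtain m where m: "y = y'" "x' = x + of_int (m * int k)" by (auto simp: algebra_simps)
      have "J (\<lfloor>x\<rfloor> + m * int k) = J \<lfloor>x\<rfloor>" using period by simp
      then show "?f (x, y) = ?f (x', y')"
        unfolding m by (simp only: prod.case chart_def floor_add_int frac_add_of_int_right)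
    qed
  qed
  moreover have "band J = ?f ` (UNIV \<times> {0<..<1})" unfolding band_def by force
  ultimately have "horizontal_cylinder n \<sigma> \<tau> (real k) 1 (band J)"
    unfolding horizontal_cylinder_def using k by auto
  then show thesis by (rule that)
qed

lemma vertex_not_in_band:
  assumes J: "row J" and v: "v \<in> vertices n \<sigma> \<tau>"
  shows "v \<notin> band J"
proof
  assume "v \<in> band J"
  then obtain u y where u: "v = chart J u y" "0 < y" "y < 1" by (auto simp: band_def)
  obtain j a b where ab: "v = point (j, a, b)" "b \<in> {0, 1}" using v by (auto simp: vertices_def)
  have "(j, a, b) \<in> chart J u y" using ab(1) u(1) self_mem_point by simp
  then have "b = y" using chart_mem_interior[OF J u(2,3)] by metis
  then show False using ab(2) u(2,3) by auto
qed

text \<open>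
  The hypothesis puts a cone point on the top of every row. A cylinder without cone points thus
  cannot meet a top side, whose leaf it would contain entirely, and so lies in a band; the band
  itself is a cylinder without vertices, so a maximal cylinder is equal to it. The marked points
  are vertices and hence are avoided by the band as well.
\<close>

lemma single_banded_if_rows_noncommuting:
  assumes M: "marking n \<sigma> \<tau> M"
    and good: "\<And>J. row J \<Longrightarrow> \<exists>m. \<tau> (\<sigma> (J m)) \<noteq> \<sigma> (\<tau> (J m))"
  shows "single_banded n \<sigma> \<tau> M"
  unfolding single_banded_def
proof (intro allI impI)
  fix Z assume Z: "maximal_horizontal_cylinder n \<sigma> \<tau> M Z"
  then have free: "Z \<inter> cone_points n \<sigma> \<tau> M = {}"
    by (simp add: maximal_horizontal_cylinder_def free_horizontal_cylinder_def)
  obtain c h f where h: "h > 0" and emb: "cylinder_embedding n \<sigma> \<tau> c h f"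
    and Zf: "Z = f ` (UNIV \<times> {0<..<h})"
    using Z by (auto simp: maximal_horizontal_cylinder_def free_horizontal_cylinder_def horizontal_cylinder_def)
  have "f p \<noteq> point (j, t, 1)" if p: "p \<in> UNIV \<times> {0<..<h}" and j: "j \<in> {1..n}" "t \<in> {0..1}" for p j t
  proof
    assume eq: "f p = point (j, t, 1)"
    obtain x0 y0 where xy: "p = (x0, y0)" "y0 \<in> {0<..<h}" using p by auto
    obtain J u a where J: "row J" "\<bar>a\<bar> = 1" and f: "\<And>x. f (x, y0) = chart J (u + a * x) 1"
      using leaf_through_top[OF emb xy(2) eq[unfolded xy(1)] j] by metis
    obtain m where m: "\<tau> (\<sigma> (J m)) \<noteq> \<sigma> (\<tau> (J m))" using good[OF J(1)] by blast
    have "f ((of_int m + 1 - u) / a, y0) = chart J (of_int m + 1) 1"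
      using f[of "(of_int m + 1 - u) / a"] J(2) by (cases "a = 0") auto
    also have "\<dots> = point (J m, 1, 1)" by (rule chart_eq_point[OF J(1)]) auto
    finally have "point (J m, 1, 1) \<in> Z" using xy(2) unfolding Zf by (metis SigmaI UNIV_I image_eqI)
    moreover have "point (J m, 1, 1) \<in> cone_points n \<sigma> \<tau> M"
      using noncommuting_corner_is_cone_point[OF rowD(1)[OF J(1)] m] by (simp add: cone_points_def)
    ultimately show False using free by blast
  qed
  then obtain J where J: "row J" and sub: "Z \<subseteq> band J"
    using cylinder_in_band[OF emb h] unfolding Zf by metis
  obtain k :: nat where k: "horizontal_cylinder n \<sigma> \<tau> (real k) 1 (band J)"
    using band_is_cylinder[OF J] .
  have "cone_points n \<sigma> \<tau> M \<subseteq> vertices n \<sigma> \<tau>"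
    using M by (auto simp: cone_points_def angular_cone_points_def marking_def)
  then have "free_horizontal_cylinder n \<sigma> \<tau> M (band J)"
    using k vertex_not_in_band[OF J] unfolding free_horizontal_cylinder_def by blast
  then have "band J = Z" using Z sub by (simp add: maximal_horizontal_cylinder_def)
  then show "\<exists>k::nat. horizontal_cylinder n \<sigma> \<tau> (real k) 1 Z" using k by auto
qed

lemma commuting_row_equivariant:
  assumes J: "row J" and comm: "\<And>m. \<tau> (\<sigma> (J m)) = \<sigma> (\<tau> (J m))"
  shows "equivariant_orbit \<sigma> \<tau> (J 0)"
proof -
  have orbit: "(\<sigma> ^^ i) (J 0) = J (int i)" for i
  proof (induction i)
    case (Suc i)
    then show ?case using rowD(2)[OF J, of "int i"] by (simp add: add.commute)
  qed simp
  have "\<tau> (J (int i)) = (\<sigma> ^^ i) (\<tau> (J 0))" for i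
  proof (induction i)
    case (Suc i)
    have "\<tau> (J (int (Suc i))) = \<tau> (\<sigma> (J (int i)))" using rowD(2)[OF J, of "int i"] by (simp add: add.commute)
    then show ?case using comm Suc by simp
  qed simp
  then show ?thesis by (simp add: equivariant_orbit_def orbit)
qed

end

lemma single_banded_or_equivariant:
  assumes "\<sigma> \<in> sym_group n" "\<tau> \<in> sym_group n" and M: "marking n \<sigma> \<tau> M"
  shows "single_banded n \<sigma> \<tau> M \<or> (\<sigma>, \<tau>) \<in> equivariant_pairs n"
proof (rule disjCI)
  interpret square_gluing n \<sigma> \<tau>
    using assms(1,2) by (simp add: square_gluing_def sym_group_def)
  assume no: "(\<sigma>, \<tau>) \<notin> equivariant_pairs n"
  show "single_banded n \<sigma> \<tau> M"
  proof (rule single_banded_if_rows_noncommuting[OF M])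
    fix J assume J: "row J"
    show "\<exists>m. \<tau> (\<sigma> (J m)) \<noteq> \<sigma> (\<tau> (J m))"
    proof (rule ccontr)
      assume "\<nexists>m. \<tau> (\<sigma> (J m)) \<noteq> \<sigma> (\<tau> (J m))"
      then have "equivariant_orbit \<sigma> \<tau> (J 0)" by (intro commuting_row_equivariant[OF J]) auto
      then show False using no assms rowD(1)[OF J, of 0] unfolding equivariant_pairs_def by blast
    qed
  qed
qed

section \<open>The asymptotic probability\<close>

theorem theorem1p1:
  fixes mk :: "nat \<Rightarrow> (nat \<Rightarrow> nat) \<Rightarrow> (nat \<Rightarrow> nat) \<Rightarrow> surface_point set"
  assumes "\<And>n \<sigma> \<tau>. \<sigma> \<in> sym_group n \<Longrightarrow> \<tau> \<in> sym_group n \<Longrightarrow> marking n \<sigma> \<tau> (mk n \<sigma> \<tau>)"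
  shows "prob_single_banded mk \<longlonglongrightarrow> 1 \<and>
    (\<lambda>n. 1 - prob_single_banded mk n) \<in> O(\<lambda>n. 1 / real n)"
proof -
  have bound: "0 \<le> 1 - prob_single_banded mk n \<and> 1 - prob_single_banded mk n \<le> 10 / real n"
    if n: "n \<ge> 3" for n
  proof -
    let ?G = "sym_group n \<times> sym_group n"
    let ?p = "pmf_of_set ?G"
    let ?E = "{(\<sigma>, \<tau>). single_banded n \<sigma> \<tau> (mk n \<sigma> \<tau>)}"
    have fin: "finite ?G" and ne: "?G \<noteq> {}"
      using finite_sym_group card_sym_group[of n] by auto
    have "1 - prob_single_banded mk n = measure_pmf.prob ?p (- ?E)"
      unfolding prob_single_banded_def using measure_pmf.prob_compl[of ?E ?p] by (simp add: Compl_eq_Diff_UNIV)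
    also have "\<dots> \<le> measure_pmf.prob ?p (equivariant_pairs n)"
    proof (rule measure_pmf.finite_measure_mono_AE)
      show "AE x in measure_pmf ?p. x \<in> - ?E \<longrightarrow> x \<in> equivariant_pairs n"
        using single_banded_or_equivariant assms set_pmf_of_set[OF ne fin]
        by (fastforce simp: AE_measure_pmf_iff)
    qed simp
    also have "\<dots> \<le> 10 / real n" by (rule prob_equivariant_pairs_le[OF n])
    finally show ?thesis by (simp add: prob_single_banded_def)
  qed
  have "(\<lambda>n. 1 - prob_single_banded mk n) \<in> O(\<lambda>n. 1 / real n)"
    using bound by (intro bigoI[of _ 10] eventually_sequentiallyI[of 3]) auto
  moreover have "(\<lambda>n. 1 - prob_single_banded mk n) \<longlonglongrightarrow> 0"
  proof (rule tendsto_sandwich)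
    show "\<forall>\<^sub>F n in sequentially. 0 \<le> 1 - prob_single_banded mk n"
      "\<forall>\<^sub>F n in sequentially. 1 - prob_single_banded mk n \<le> 10 / real n"
      using bound by (auto intro: eventually_sequentiallyI[of 3])
    show "(\<lambda>n. 10 / real n) \<longlonglongrightarrow> 0" by (rule lim_const_over_n)
  qed simp
  then have "prob_single_banded mk \<longlonglongrightarrow> 1"
    using tendsto_diff[OF tendsto_const[of 1], of "\<lambda>n. 1 - prob_single_banded mk n" 0] by simp
  ultimately show ?thesis by blast
qed

end
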